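(* Let $k$ be an algebraically closed field of characteristic zero, let $u\in k$ be a primitive root of unity of order $10$, let $\ell\ge 1$, and let $\mathcal{F}_u^{\boxtimes \ell}$ be the $\ell$-fold Deligne tensor power of the Fibonacci modular category $\mathcal{F}_u$. Then $\mathcal{F}_u^{\boxtimes\ell}$ has no non-trivial simple, separable, commutative, ribbon algebras; that is, every simple, separable, commutative, ribbon algebra in $\mathcal{F}_u^{\boxtimes\ell}$ is isomorphic to the unit object $I$ with its canonical algebra structure. (In other words, $\mathcal{F}_u^{\boxtimes\ell}$ is completely anisotropic.)
   Context: The Fibonacci modular category $\mathcal{F}_u$: let $u$ be a primitive $10$-th root of unity in $k$ and $a=u+u^{-1}$ (so $a^2=a+1$). $\mathcal{F}_u$ is the semisimple $k$-linear category with two simple objects $I$ (strict monoidal unit) and $X$, and $X\otimes X=I\oplus X$. Fix basis vectors $\mu\in\mathrm{Hom}(X\otimes X,X)$ and $\varepsilon\in\mathrm{Hom}(X\otimes X,I)$. The associativity constraint $\alpha_{X,X,X}:(X\otimes X)\otimes X\to X\otimes (X\otimes X)$ is determined by $\varepsilon(1\otimes\mu)\circ\alpha_{X,X,X}=\varepsilon(\mu\otimes 1)$, $\ \mu(1\otimes\mu)\circ\alpha_{X,X,X}=a\,\mu(\mu\otimes1)+(\varepsilon\otimes 1)$, $\ (1\otimes\varepsilon)\circ\alpha_{X,X,X}=-a\,\mu(\mu\otimes1)-a\,(\varepsilon\otimes1)$. The braiding is given by $\mu\circ c_{X,X}=u\,\mu$, $\varepsilon\circ c_{X,X}=u^2\,\varepsilon$,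 and the ribbon twist by $\theta_I=\mathrm{id}_I$, $\theta_X=u^{-2}\mathrm{id}_X$. The Deligne tensor product $\mathcal{C}\boxtimes\mathcal{D}$ of fusion categories has simple objects $Y\boxtimes Z$ ($Y$, $Z$ simple) and componentwise tensor product, braiding and twist. Algebras: an algebra in a monoidal category is an object $A$ with associative multiplication $\mu_A:A\otimes A\to A$ and unit $\iota:I\to A$. It is simple if any non-zero algebra homomorphism out of it is injective. In a braided rigid category, it is commutative if $\mu_A c_{A,A}=\mu_A$. It is separable if the pairing $e=\epsilon_A\circ\mu_A:A\otimes A\to I$ is non-degenerate, where $\epsilon_A$ is the composite $A\to A\otimes A\otimes A^*\xrightarrow{\mu_A\otimes1}A\otimes A^*\xrightarrow{c_{A,A^*}}A^*\otimes A\xrightarrow{ev_A}I$ (the first arrow is $1\otimes\mathrm{coev}_A$). Non-degenerate means that there is $\kappa:I\to A\otimes A$ with $(e\otimes1)(1\otimes\kappa)=\mathrm{id}_A$. In a ribbon category, a commutative algebra $A$ is ribbon if $\theta_A=\mathrm{id}_A$. *)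

theory Defs
  imports "HOL-Computational_Algebra.Polynomial"
begin

section \<open>Rigid braided categories with twist\<close>

text \<open>
  Only the structure maps are recorded, not the axioms; of the linear structure only the
  zero morphisms are needed. Composition is written in the usual order: \<open>g \<cdot> f\<close> is
  \<open>f\<close> followed by \<open>g\<close>.
\<close>

record ('o, 'm) ribbon_cat =
  Obj :: "'o set"
  Hom :: "'o \<Rightarrow> 'o \<Rightarrow> 'm set"
  Idm :: "'o \<Rightarrow> 'm"  ("\<one>\<index>")
  Comp :: "'m \<Rightarrow> 'm \<Rightarrow> 'm"  (infixr "\<cdot>\<index>" 55)
  Zero :: "'o \<Rightarrow> 'o \<Rightarrow> 'm"
  TensO :: "'o \<Rightarrow> 'o \<Rightarrow> 'o"  (infixr "\<odot>\<index>" 70)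
  TensM :: "'m \<Rightarrow> 'm \<Rightarrow> 'm"  (infixr "\<otimes>\<index>" 70)
  Unit :: "'o"  ("\<I>\<index>")
  Lunit :: "'o \<Rightarrow> 'm"          \<comment> \<open>\<open>I \<odot> A \<rightarrow> A\<close>\<close>
  Runit :: "'o \<Rightarrow> 'm"          \<comment> \<open>\<open>A \<odot> I \<rightarrow> A\<close>\<close>
  Assoc :: "'o \<Rightarrow> 'o \<Rightarrow> 'o \<Rightarrow> 'm"  \<comment> \<open>\<open>(A \<odot> B) \<odot> C \<rightarrow> A \<odot> (B \<odot> C)\<close>\<close>
  Braid :: "'o \<Rightarrow> 'o \<Rightarrow> 'm"      \<comment> \<open>\<open>A \<odot> B \<rightarrow> B \<odot> A\<close>\<close>
  Dual :: "'o \<Rightarrow> 'o"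
  Ev :: "'o \<Rightarrow> 'm"            \<comment> \<open>\<open>A\<^sup>* \<odot> A \<rightarrow> I\<close>\<close>
  Coev :: "'o \<Rightarrow> 'm"          \<comment> \<open>\<open>I \<rightarrow> A \<odot> A\<^sup>*\<close>\<close>
  Twist :: "'o \<Rightarrow> 'm"

definition inverse_arrow :: "('o, 'm) ribbon_cat \<Rightarrow> 'o \<Rightarrow> 'o \<Rightarrow> 'm \<Rightarrow> 'm" where
  "inverse_arrow C A B f =
     (THE g. g \<in> Hom C B A \<and> Comp C g f = Idm C A \<and> Comp C f g = Idm C B)"

definition iso_arrow :: "('o, 'm) ribbon_cat \<Rightarrow> 'o \<Rightarrow> 'o \<Rightarrow> 'm \<Rightarrow> bool" where
  "iso_arrow C A B f \<longleftrightarrow> f \<in> Hom C A B \<and>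
     (\<exists>g \<in> Hom C B A. Comp C g f = Idm C A \<and> Comp C f g = Idm C B)"

definition mono_arrow :: "('o, 'm) ribbon_cat \<Rightarrow> 'o \<Rightarrow> 'o \<Rightarrow> 'm \<Rightarrow> bool" where
  "mono_arrow C A B f \<longleftrightarrow> f \<in> Hom C A B \<and>
     (\<forall>Z \<in> Obj C. \<forall>g \<in> Hom C Z A. \<forall>h \<in> Hom C Z A. Comp C f g = Comp C f h \<longrightarrow> g = h)"


section \<open>Algebras\<close>

record ('o, 'm) alg =
  car :: 'o
  mult :: 'm
  unit :: 'm

definition is_algebra :: "('o, 'm) ribbon_cat \<Rightarrow> ('o, 'm) alg \<Rightarrow> bool" where
  "is_algebra C \<A> \<longleftrightarrow>
     (let A = car \<A>; \<mu> = mult \<A>; \<iota> = unit \<A> in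
        A \<in> Obj C \<and> \<mu> \<in> Hom C (A \<odot>\<^bsub>C\<^esub> A) A \<and> \<iota> \<in> Hom C \<I>\<^bsub>C\<^esub> A \<and>
        \<mu> \<cdot>\<^bsub>C\<^esub> (\<mu> \<otimes>\<^bsub>C\<^esub> \<one>\<^bsub>C\<^esub> A) = \<mu> \<cdot>\<^bsub>C\<^esub> (\<one>\<^bsub>C\<^esub> A \<otimes>\<^bsub>C\<^esub> \<mu>) \<cdot>\<^bsub>C\<^esub> Assoc C A A A \<and>
        \<mu> \<cdot>\<^bsub>C\<^esub> (\<iota> \<otimes>\<^bsub>C\<^esub> \<one>\<^bsub>C\<^esub> A) = Lunit C A \<and>
        \<mu> \<cdot>\<^bsub>C\<^esub> (\<one>\<^bsub>C\<^esub> A \<otimes>\<^bsub>C\<^esub> \<iota>) = Runit C A)"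

definition alg_hom :: "('o, 'm) ribbon_cat \<Rightarrow> ('o, 'm) alg \<Rightarrow> ('o, 'm) alg \<Rightarrow> 'm \<Rightarrow> bool" where
  "alg_hom C \<A> \<B> f \<longleftrightarrow> f \<in> Hom C (car \<A>) (car \<B>) \<and>
     f \<cdot>\<^bsub>C\<^esub> mult \<A> = mult \<B> \<cdot>\<^bsub>C\<^esub> (f \<otimes>\<^bsub>C\<^esub> f) \<and> f \<cdot>\<^bsub>C\<^esub> unit \<A> = unit \<B>"

definition alg_isomorphic :: "('o, 'm) ribbon_cat \<Rightarrow> ('o, 'm) alg \<Rightarrow> ('o, 'm) alg \<Rightarrow> bool" where
  "alg_isomorphic C \<A> \<B> \<longleftrightarrow> (\<exists>f. alg_hom C \<A> \<B> f \<and> iso_arrow C (car \<A>) (car \<B>) f)"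

definition unit_alg :: "('o, 'm) ribbon_cat \<Rightarrow> ('o, 'm) alg" where
  "unit_alg C = \<lparr>car = \<I>\<^bsub>C\<^esub>, mult = Lunit C \<I>\<^bsub>C\<^esub>, unit = \<one>\<^bsub>C\<^esub> \<I>\<^bsub>C\<^esub>\<rparr>"

text \<open>
  As for rings, the zero algebra is not simple. This has to be required separately: every
  homomorphism out of the zero algebra is zero, so the second condition holds for it vacuously.
\<close>

definition simple_alg :: "('o, 'm) ribbon_cat \<Rightarrow> ('o, 'm) alg \<Rightarrow> bool" where
  "simple_alg C \<A> \<longleftrightarrow> \<one>\<^bsub>C\<^esub> (car \<A>) \<noteq> Zero C (car \<A>) (car \<A>) \<and>
     (\<forall>\<B> f. is_algebra C \<B> \<and> alg_hom C \<A> \<B> f \<and> f \<noteq> Zero C (car \<A>) (car \<B>)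
        \<longrightarrow> mono_arrow C (car \<A>) (car \<B>) f)"

definition commutative_alg :: "('o, 'm) ribbon_cat \<Rightarrow> ('o, 'm) alg \<Rightarrow> bool" where
  "commutative_alg C \<A> \<longleftrightarrow> mult \<A> \<cdot>\<^bsub>C\<^esub> Braid C (car \<A>) (car \<A>) = mult \<A>"

definition ribbon_alg :: "('o, 'm) ribbon_cat \<Rightarrow> ('o, 'm) alg \<Rightarrow> bool" where
  "ribbon_alg C \<A> \<longleftrightarrow> Twist C (car \<A>) = \<one>\<^bsub>C\<^esub> (car \<A>)"

definition alg_trace :: "('o, 'm) ribbon_cat \<Rightarrow> ('o, 'm) alg \<Rightarrow> 'm" where
  "alg_trace C \<A> =
     (let A = car \<A>; A' = Dual C A in
        Ev C A \<cdot>\<^bsub>C\<^esub> Braid C A A' \<cdot>\<^bsub>C\<^esub> (mult \<A> \<otimes>\<^bsub>C\<^esub> \<one>\<^bsub>C\<^esub> A')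
        \<cdot>\<^bsub>C\<^esub> inverse_arrow C ((A \<odot>\<^bsub>C\<^esub> A) \<odot>\<^bsub>C\<^esub> A') (A \<odot>\<^bsub>C\<^esub> (A \<odot>\<^bsub>C\<^esub> A')) (Assoc C A A A')
        \<cdot>\<^bsub>C\<^esub> (\<one>\<^bsub>C\<^esub> A \<otimes>\<^bsub>C\<^esub> Coev C A)
        \<cdot>\<^bsub>C\<^esub> inverse_arrow C (A \<odot>\<^bsub>C\<^esub> \<I>\<^bsub>C\<^esub>) A (Runit C A))"

definition nondegenerate :: "('o, 'm) ribbon_cat \<Rightarrow> 'o \<Rightarrow> 'm \<Rightarrow> bool" where
  "nondegenerate C A e \<longleftrightarrow>
     (\<exists>\<kappa> \<in> Hom C \<I>\<^bsub>C\<^esub> (A \<odot>\<^bsub>C\<^esub> A).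
        Lunit C A \<cdot>\<^bsub>C\<^esub> (e \<otimes>\<^bsub>C\<^esub> \<one>\<^bsub>C\<^esub> A)
        \<cdot>\<^bsub>C\<^esub> inverse_arrow C ((A \<odot>\<^bsub>C\<^esub> A) \<odot>\<^bsub>C\<^esub> A) (A \<odot>\<^bsub>C\<^esub> (A \<odot>\<^bsub>C\<^esub> A)) (Assoc C A A A)
        \<cdot>\<^bsub>C\<^esub> (\<one>\<^bsub>C\<^esub> A \<otimes>\<^bsub>C\<^esub> \<kappa>)
        \<cdot>\<^bsub>C\<^esub> inverse_arrow C (A \<odot>\<^bsub>C\<^esub> \<I>\<^bsub>C\<^esub>) A (Runit C A) = \<one>\<^bsub>C\<^esub> A)"

definition separable_alg :: "('o, 'm) ribbon_cat \<Rightarrow> ('o, 'm) alg \<Rightarrow> bool" where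
  "separable_alg C \<A> \<longleftrightarrow> nondegenerate C (car \<A>) (alg_trace C \<A> \<cdot>\<^bsub>C\<^esub> mult \<A>)"


section \<open>Semisimple categories from fusion data\<close>

text \<open>
  Data of a multiplicity-free ribbon category with self-dual simple objects. For simple \<open>a, b\<close>
  and \<open>c \<in> fus a b\<close> fix a basis vector \<open>\<mu>(a,b,c)\<close> of the line \<open>Hom(a \<otimes> b, c)\<close>. Then
  \<^item> \<open>\<mu>(a,f,d) (1 \<otimes> \<mu>(b,c,f)) \<alpha> = (\<Sum>e. Fsym a b c d e f * \<mu>(e,c,d) (\<mu>(a,b,e) \<otimes> 1))\<close>,
    where \<open>\<alpha>\<close> is the associator of \<open>a, b, c\<close>;
  \<^item> \<open>\<mu>(b,a,c)\<close> composed with the braiding of \<open>a, b\<close> is \<open>Rsym a b c * \<mu>(a,b,c)\<close>;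
  \<^item> the twist of \<open>a\<close> is the scalar \<open>twsym a\<close>.
\<close>

record ('l, 'k) fusion_data =
  simples :: "'l set"
  one :: 'l
  fus :: "'l \<Rightarrow> 'l \<Rightarrow> 'l set"
  Fsym :: "'l \<Rightarrow> 'l \<Rightarrow> 'l \<Rightarrow> 'l \<Rightarrow> 'l \<Rightarrow> 'l \<Rightarrow> 'k"
  Rsym :: "'l \<Rightarrow> 'l \<Rightarrow> 'l \<Rightarrow> 'k"
  twsym :: "'l \<Rightarrow> 'k"

text \<open>
  An object is a finite formal direct sum of simple objects, given as a finite set of summands
  that carry their simple object as a label. In \<open>A \<otimes> B\<close> the summand \<open>Node c i j\<close> is the copy of
  \<open>c\<close> in \<open>i \<otimes> j\<close>, with projection \<open>\<mu>(lab i, lab j, c)\<close>. Leaves with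
  different numbers are different copies of the same simple object. By Schur's lemma, a
  morphism is a matrix of scalars that vanishes between summands with different labels.
\<close>

datatype 'l summand =
    Leaf (lab: 'l) nat
  | Node (lab: 'l) "'l summand" "'l summand"

type_synonym 'l sobj = "'l summand set"

datatype ('l, 'k) arrow =
  Arrow (src: "'l sobj") (tgt: "'l sobj") (ent: "'l summand \<Rightarrow> 'l summand \<Rightarrow> 'k")

text \<open>In \<open>ent f y x\<close> the row index \<open>y\<close> belongs to the target and the column index \<open>x\<close> to the source.\<close>

definition mk_arrow :: "'l sobj \<Rightarrow> 'l sobj \<Rightarrow> ('l summand \<Rightarrow> 'l summand \<Rightarrow> 'k) \<Rightarrow> ('l, 'k::zero) arrow" where
  "mk_arrow A B p = Arrow A B (\<lambda>y x. if x \<in> A \<and> y \<in> B \<and> lab y = lab x then p y x else 0)"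

definition hom_set :: "'l sobj \<Rightarrow> 'l sobj \<Rightarrow> ('l, 'k::zero) arrow set" where
  "hom_set A B = {f. src f = A \<and> tgt f = B \<and>
     (\<forall>y x. ent f y x \<noteq> 0 \<longrightarrow> x \<in> A \<and> y \<in> B \<and> lab y = lab x)}"

definition comp_arrow :: "('l, 'k) arrow \<Rightarrow> ('l, 'k) arrow \<Rightarrow> ('l, 'k::semiring_0) arrow" where
  "comp_arrow g f = mk_arrow (src f) (tgt g) (\<lambda>z x. \<Sum>y\<in>tgt f. ent g z y * ent f y x)"

definition tens_obj :: "('l, 'k) fusion_data \<Rightarrow> 'l sobj \<Rightarrow> 'l sobj \<Rightarrow> 'l sobj" where
  "tens_obj D A B = {Node c i j | c i j. i \<in> A \<and> j \<in> B \<and> c \<in> fus D (lab i) (lab j)}"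

fun tens_ent :: "('l, 'k) arrow \<Rightarrow> ('l, 'k) arrow \<Rightarrow> 'l summand \<Rightarrow> 'l summand \<Rightarrow> 'k::semiring_0" where
  "tens_ent f g (Node c' i' j') (Node c i j) = ent f i' i * ent g j' j"
| "tens_ent f g _ _ = 0"

definition tens_arrow :: "('l, 'k) fusion_data \<Rightarrow> ('l, 'k) arrow \<Rightarrow> ('l, 'k) arrow \<Rightarrow> ('l, 'k::semiring_0) arrow" where
  "tens_arrow D f g =
     mk_arrow (tens_obj D (src f) (src g)) (tens_obj D (tgt f) (tgt g)) (tens_ent f g)"

fun assoc_ent :: "('l, 'k) fusion_data \<Rightarrow> 'l summand \<Rightarrow> 'l summand \<Rightarrow> 'k::zero" where
  "assoc_ent D (Node d' i' (Node f j' k')) (Node d (Node e i j) k) =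
     (if i' = i \<and> j' = j \<and> k' = k then Fsym D (lab i) (lab j) (lab k) d e f else 0)"
| "assoc_ent D _ _ = 0"

fun braid_ent :: "('l, 'k) fusion_data \<Rightarrow> 'l summand \<Rightarrow> 'l summand \<Rightarrow> 'k::zero" where
  "braid_ent D (Node c' j' i') (Node c i j) =
     (if i' = i \<and> j' = j then Rsym D (lab i) (lab j) c else 0)"
| "braid_ent D _ _ = 0"

definition unit_summand :: "('l, 'k) fusion_data \<Rightarrow> 'l summand" where
  "unit_summand D = Leaf (one D) 0"

fun ev_ent :: "'l summand \<Rightarrow> 'k::zero_neq_one" where
  "ev_ent (Node c i j) = of_bool (i = j)"
| "ev_ent _ = 0"

fun coev_ent :: "('l, 'k) fusion_data \<Rightarrow> 'l summand \<Rightarrow> 'k::field" where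
  "coev_ent D (Node c i j) =
     (if i = j then inverse (Fsym D (lab i) (lab i) (lab i) (lab i) (one D) (one D)) else 0)"
| "coev_ent D _ = 0"

text \<open>
  Simple objects are self-dual, so every object serves as its own dual. The evaluation is
  normalised to \<open>\<mu>(a,a,one)\<close> on each simple \<open>a\<close>; the coefficient of the coevaluation is then
  forced by the snake identity \<open>(1 \<otimes> ev) \<alpha> (coev \<otimes> 1) = 1\<close>.
\<close>

definition cat_of :: "('l, 'k::field) fusion_data \<Rightarrow> ('l sobj, ('l, 'k) arrow) ribbon_cat" where
  "cat_of D =
     (let U = {unit_summand D} in
      \<lparr>Obj = {A. finite A \<and> lab ` A \<subseteq> simples D},
       Hom = hom_set,
       Idm = (\<lambda>A. mk_arrow A A (\<lambda>y x. of_bool (y = x))),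
       Comp = comp_arrow,
       Zero = (\<lambda>A B. mk_arrow A B (\<lambda>y x. 0)),
       TensO = tens_obj D,
       TensM = tens_arrow D,
       Unit = U,
       Lunit = (\<lambda>A. mk_arrow (tens_obj D U A) A
                  (\<lambda>y x. of_bool (x = Node (lab y) (unit_summand D) y))),
       Runit = (\<lambda>A. mk_arrow (tens_obj D A U) A
                  (\<lambda>y x. of_bool (x = Node (lab y) y (unit_summand D)))),
       Assoc = (\<lambda>A B C. mk_arrow (tens_obj D (tens_obj D A B) C) (tens_obj D A (tens_obj D B C))
                  (assoc_ent D)),
       Braid = (\<lambda>A B. mk_arrow (tens_obj D A B) (tens_obj D B A) (braid_ent D)),
       Dual = (\<lambda>A. A),
       Ev = (\<lambda>A. mk_arrow (tens_obj D A A) U (\<lambda>y x. ev_ent x)),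
       Coev = (\<lambda>A. mk_arrow U (tens_obj D A A) (\<lambda>y x. coev_ent D y)),
       Twist = (\<lambda>A. mk_arrow A A (\<lambda>y x. if y = x then twsym D (lab x) else 0))\<rparr>)"


section \<open>The Fibonacci category and its Deligne powers\<close>

datatype fib = I | X

fun fib_fus :: "fib \<Rightarrow> fib \<Rightarrow> fib set" where
  "fib_fus I b = {b}"
| "fib_fus X I = {X}"
| "fib_fus X X = {I, X}"

text \<open>
  With \<open>\<mu> = \<mu>(X,X,X)\<close> and \<open>\<epsilon> = \<mu>(X,X,I)\<close>, a path through \<open>(X \<otimes> X) \<otimes> X\<close> to \<open>X\<close> is
  \<open>\<mu>(\<mu> \<otimes> 1)\<close> for \<open>e = X\<close> and \<open>\<epsilon> \<otimes> 1\<close> for \<open>e = I\<close>; a path through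
  \<open>X \<otimes> (X \<otimes> X)\<close> to \<open>X\<close> is \<open>\<mu>(1 \<otimes> \<mu>)\<close> for \<open>f = X\<close> and \<open>1 \<otimes> \<epsilon>\<close> for \<open>f = I\<close>.
  All other symbols are \<open>1\<close>: to \<open>I\<close> there is one path \<open>\<epsilon>(\<mu> \<otimes> 1)\<close> and one path
  \<open>\<epsilon>(1 \<otimes> \<mu>)\<close>, and \<open>I\<close> is a strict unit.
\<close>

fun fib_F :: "'k::field \<Rightarrow> fib \<Rightarrow> fib \<Rightarrow> fib \<Rightarrow> fib \<Rightarrow> fib \<Rightarrow> fib \<Rightarrow> 'k" where
  "fib_F a X X X X X X = a"
| "fib_F a X X X X I X = 1"
| "fib_F a X X X X X I = - a"
| "fib_F a X X X X I I = - a"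
| "fib_F a _ _ _ _ _ _ = 1"

fun fib_R :: "'k::field \<Rightarrow> fib \<Rightarrow> fib \<Rightarrow> fib \<Rightarrow> 'k" where
  "fib_R u X X X = u"
| "fib_R u X X I = u ^ 2"
| "fib_R u _ _ _ = 1"

definition fib_data :: "'k::field \<Rightarrow> (fib, 'k) fusion_data" where
  "fib_data u =
     \<lparr>simples = {I, X}, one = I, fus = fib_fus, Fsym = fib_F (u + inverse u), Rsym = fib_R u,
      twsym = (\<lambda>a. case a of I \<Rightarrow> 1 | X \<Rightarrow> inverse (u ^ 2))\<rparr>"

text \<open>The list \<open>[a\<^sub>1, \<dots>, a\<^sub>l]\<close> stands for the simple object \<open>a\<^sub>1 \<boxtimes> \<dots> \<boxtimes> a\<^sub>l\<close>.\<close>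

definition deligne_power :: "('l, 'k::comm_monoid_mult) fusion_data \<Rightarrow> nat \<Rightarrow> ('l list, 'k) fusion_data" where
  "deligne_power D l =
     \<lparr>simples = {w. length w = l \<and> set w \<subseteq> simples D},
      one = replicate l (one D),
      fus = (\<lambda>v w. {z. length z = l \<and> (\<forall>n<l. z ! n \<in> fus D (v ! n) (w ! n))}),
      Fsym = (\<lambda>a b c d e f. \<Prod>n<l. Fsym D (a ! n) (b ! n) (c ! n) (d ! n) (e ! n) (f ! n)),
      Rsym = (\<lambda>a b c. \<Prod>n<l. Rsym D (a ! n) (b ! n) (c ! n)),
      twsym = (\<lambda>a. \<Prod>n<l. twsym D (a ! n))\<rparr>"

definition fib_power :: "'k::field \<Rightarrow> nat \<Rightarrow> (fib list sobj, (fib list, 'k) arrow) ribbon_cat" where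
  "fib_power u l = cat_of (deligne_power (fib_data u) l)"

end

theory Submission
  imports "Jordan_Normal_Form.Char_Poly" Defs
begin

text \<open>
  Over an algebraically closed field, \<open>Hom(I, A)\<close> is a line when \<open>A\<close> is simple and commutative:
  for an eigenvalue \<open>c\<close> of multiplication by \<open>t \<in> Hom(I, A)\<close>, the kernel of multiplication
  by \<open>t - c\<close> is a non-zero ideal, so it is everything.

  Suppose that \<open>A\<close> has a non-unit simple summand and choose one, \<open>w\<close>, with the least number \<open>m\<close> of
  factors \<open>X\<close>. The twist of \<open>w\<close> is \<open>u\<^sup>-\<^sup>2\<^sup>m\<close>, so the ribbon condition gives \<open>m \<ge> 3\<close>.
  By minimality, products of elements of \<open>A\<^sub>w\<close> have components only in \<open>I\<close> and \<open>w\<close>.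
  Associativity, compared in a channel with \<open>0 < r < m\<close> factors \<open>X\<close>, reads
  \<open>0 = (-a)\<^sup>m x(y,z) + a\<^sup>r x[y,z]\<close> with \<open>(y,z)\<close> and \<open>[y,z]\<close> the two components of \<open>yz\<close>. As
  \<open>a \<noteq> a\<^sup>2\<close>, the cases \<open>r = 1, 2\<close> give \<open>(y,z) = 0\<close>, which contradicts the non-degeneracy of
  the trace pairing on \<open>A\<^sub>w\<close>.
\<close>

section \<open>Matrix calculus in semisimple categories\<close>

text \<open>Simplicity speaks only of homomorphisms out of \<open>A\<close>. An ideal can contradict
  it only after the quotient has been realised as an algebra on a finite set of summands, which is
  why a quotient construction in coordinates precedes the argument. The relation for a channel has 0
  on its left because that side runs over the summands of \<open>A\<close> labelled by the channel,
  and minimality of m excludes them. Its right side comes from the F-matrix of three factors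
  \<open>X\<close> mapping to \<open>X\<close>: the row of \<open>I\<close> is constant, -a in both
  channels, and contributes one factor per \<open>X\<close> in w; the row of \<open>X\<close> is a
  in channel \<open>X\<close> and 1 in channel \<open>I\<close>, so only the r factors of the
  channel count. Hence r enters one coefficient and not the other, and two values of r eliminate
  x[y,z]. Two values with 0 < r < m need m at least 3, and the twist provides this because neither
  u^2 nor u^4 is 1. Connectedness makes (y,z) a single scalar, and the unit law makes multiplication
  by the unit summand invertible, so x(y,z) = 0 gives (y,z) = 0.\<close>

lemma ent_mk_arrow [simp]:
  "ent (mk_arrow A B p) y x = (if x \<in> A \<and> y \<in> B \<and> lab y = lab x then p y x else 0)"
  by (simp add: mk_arrow_def)

lemma src_mk_arrow [simp]: "src (mk_arrow A B p) = A"
  by (simp add: mk_arrow_def)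

lemma tgt_mk_arrow [simp]: "tgt (mk_arrow A B p) = B"
  by (simp add: mk_arrow_def)

lemma src_comp_arrow [simp]: "src (comp_arrow g f) = src f"
  and tgt_comp_arrow [simp]: "tgt (comp_arrow g f) = tgt g"
  by (simp_all add: comp_arrow_def)

lemma ent_comp_arrow:
  "ent (comp_arrow g f) z x =
     (if x \<in> src f \<and> z \<in> tgt g \<and> lab z = lab x then \<Sum>y\<in>tgt f. ent g z y * ent f y x else 0)"
  by (simp add: comp_arrow_def)

lemma src_tens_arrow [simp]: "src (tens_arrow D f g) = tens_obj D (src f) (src g)"
  and tgt_tens_arrow [simp]: "tgt (tens_arrow D f g) = tens_obj D (tgt f) (tgt g)"
  by (simp_all add: tens_arrow_def)

lemma ent_tens_arrow:
  "ent (tens_arrow D f g) y x =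
     (if x \<in> tens_obj D (src f) (src g) \<and> y \<in> tens_obj D (tgt f) (tgt g) \<and> lab y = lab x
      then tens_ent f g y x else 0)"
  by (simp add: tens_arrow_def)

lemma mk_arrow_in_hom_set [simp]: "mk_arrow A B p \<in> hom_set A B"
  by (auto simp: hom_set_def split: if_splits)

lemma comp_arrow_in_hom_set: "comp_arrow g f \<in> hom_set (src f) (tgt g)"
  by (simp add: comp_arrow_def)

lemma hom_setD:
  assumes "f \<in> hom_set A B"
  shows "src f = A" "tgt f = B"
    and "ent f y x \<noteq> 0 \<Longrightarrow> x \<in> A \<and> y \<in> B \<and> lab y = lab x"
  using assms by (auto simp: hom_set_def)

lemma hom_set_eqI:
  assumes f: "f \<in> hom_set A B" and g: "g \<in> hom_set A B"
    and ent: "\<And>x y. x \<in> A \<Longrightarrow> y \<in> B \<Longrightarrow> lab y = lab x \<Longrightarrow> ent f y x = ent g y x"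
  shows "f = g"
proof -
  have "ent f y x = ent g y x" for y x
    using hom_setD(3)[OF f] hom_setD(3)[OF g] ent by metis
  then show ?thesis
    using hom_setD(1,2)[OF f] hom_setD(1,2)[OF g] by (intro arrow.expand) auto
qed

text \<open>This is the exchange of two finite sums. Composition masks entries between different
  labels; the hypotheses guarantee that a masked entry is always multiplied by one that is already
  zero.\<close>

lemma comp_arrow_assoc:
  fixes f g h :: "('l, 'k::semiring_0) arrow"
  assumes "f \<in> hom_set A B" "g \<in> hom_set B C" "h \<in> hom_set C E"
  shows "comp_arrow h (comp_arrow g f) = comp_arrow (comp_arrow h g) f"
proof (rule hom_set_eqI)
  note s = hom_setD(1,2)[OF assms(1)] hom_setD(1,2)[OF assms(2)] hom_setD(1,2)[OF assms(3)]
  show "comp_arrow h (comp_arrow g f) \<in> hom_set A E" "comp_arrow (comp_arrow h g) f \<in> hom_set A E"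
    using comp_arrow_in_hom_set[of h "comp_arrow g f"] comp_arrow_in_hom_set[of "comp_arrow h g" f]
    by (simp_all add: s)
  fix x y assume xy: "x \<in> A" "y \<in> E" "lab y = lab x"
  have 1: "ent h y c * ent (comp_arrow g f) c x = (\<Sum>b\<in>B. ent h y c * (ent g c b * ent f b x))"
    if "c \<in> C" for c
    using that xy hom_setD(3)[OF assms(3), of y c]
    by (cases "ent h y c = 0") (auto simp: ent_comp_arrow s sum_distrib_left)
  have 2: "ent (comp_arrow h g) y b * ent f b x = (\<Sum>c\<in>C. ent h y c * (ent g c b * ent f b x))"
    if "b \<in> B" for b
    using that xy hom_setD(3)[OF assms(1), of b x]
    by (cases "ent f b x = 0") (auto simp: ent_comp_arrow s sum_distrib_right mult.assoc)
  have "ent (comp_arrow h (comp_arrow g f)) y x = (\<Sum>c\<in>C. \<Sum>b\<in>B. ent h y c * (ent g c b * ent f b x))"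
    using xy 1 by (subst ent_comp_arrow) (simp add: s)
  also have "\<dots> = (\<Sum>b\<in>B. \<Sum>c\<in>C. ent h y c * (ent g c b * ent f b x))"
    by (rule sum.swap)
  also have "\<dots> = ent (comp_arrow (comp_arrow h g) f) y x"
    using xy 2 by (subst ent_comp_arrow) (simp add: s)
  finally show "ent (comp_arrow h (comp_arrow g f)) y x = ent (comp_arrow (comp_arrow h g) f) y x" .
qed

abbreviation id_arrow :: "'l sobj \<Rightarrow> ('l, 'k::zero_neq_one) arrow" where
  "id_arrow A \<equiv> mk_arrow A A (\<lambda>y x. of_bool (y = x))"

lemma comp_arrow_id:
  fixes f :: "('l, 'k::semiring_1) arrow"
  assumes f: "f \<in> hom_set A B"
  shows "finite B \<Longrightarrow> comp_arrow (id_arrow B) f = f"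
    and "finite A \<Longrightarrow> comp_arrow f (id_arrow A) = f"
proof -
  note s = hom_setD(1,2)[OF f]
  show "comp_arrow (id_arrow B) f = f" if "finite B"
  proof (rule hom_set_eqI[of _ A B])
    show "comp_arrow (id_arrow B) f \<in> hom_set A B"
      using comp_arrow_in_hom_set[of "id_arrow B" f] by (simp add: s)
    fix x y assume xy: "x \<in> A" "y \<in> B" "lab y = lab x"
    have "(\<Sum>z\<in>B. ent (id_arrow B) y z * ent f z x) = (\<Sum>z\<in>B. if z = y then ent f z x else 0)"
      by (intro sum.cong) (use xy in auto)
    then show "ent (comp_arrow (id_arrow B) f) y x = ent f y x"
      using xy that by (simp add: ent_comp_arrow s)
  qed (fact f)
  show "comp_arrow f (id_arrow A) = f" if "finite A"
  proof (rule hom_set_eqI[of _ A B])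
    show "comp_arrow f (id_arrow A) \<in> hom_set A B"
      using comp_arrow_in_hom_set[of f "id_arrow A"] by (simp add: s)
    fix x y assume xy: "x \<in> A" "y \<in> B" "lab y = lab x"
    have "(\<Sum>z\<in>A. ent f y z * ent (id_arrow A) z x) = (\<Sum>z\<in>A. if z = x then ent f y z else 0)"
      by (intro sum.cong) (use xy in auto)
    then show "ent (comp_arrow f (id_arrow A)) y x = ent f y x"
      using xy that by (simp add: ent_comp_arrow s)
  qed (fact f)
qed

lemma cat_of_simps [simp]:
  "Obj (cat_of D) = {A. finite A \<and> lab ` A \<subseteq> simples D}"
  "Hom (cat_of D) = hom_set"
  "Idm (cat_of D) A = id_arrow A"
  "Comp (cat_of D) = comp_arrow"
  "Zero (cat_of D) A B = mk_arrow A B (\<lambda>y x. 0)"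
  "TensO (cat_of D) = tens_obj D"
  "TensM (cat_of D) = tens_arrow D"
  "Unit (cat_of D) = {unit_summand D}"
  "Lunit (cat_of D) A = mk_arrow (tens_obj D {unit_summand D} A) A
                  (\<lambda>y x. of_bool (x = Node (lab y) (unit_summand D) y))"
  "Runit (cat_of D) A = mk_arrow (tens_obj D A {unit_summand D}) A
                  (\<lambda>y x. of_bool (x = Node (lab y) y (unit_summand D)))"
  "Assoc (cat_of D) A B C = mk_arrow (tens_obj D (tens_obj D A B) C) (tens_obj D A (tens_obj D B C))
                  (assoc_ent D)"
  "Braid (cat_of D) A B = mk_arrow (tens_obj D A B) (tens_obj D B A) (braid_ent D)"
  "Dual (cat_of D) A = A"
  "Ev (cat_of D) A = mk_arrow (tens_obj D A A) {unit_summand D} (\<lambda>y x. ev_ent x)"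
  "Twist (cat_of D) A = mk_arrow A A (\<lambda>y x. if y = x then twsym D (lab x) else 0)"
  by (simp_all add: cat_of_def Let_def)

text \<open>\<open>inverse_arrow\<close> is a definite description, so the inverse associators and
  unitors inside trace and non-degeneracy become computable once an explicit inverse has been shown
  to be the only one.\<close>

lemma inverse_arrow_eqI:
  fixes D :: "('l, 'k::field) fusion_data"
  assumes "finite A" "finite B" and f: "f \<in> hom_set A B" and g: "g \<in> hom_set B A"
    and gf: "comp_arrow g f = id_arrow A" and fg: "comp_arrow f g = id_arrow B"
  shows "inverse_arrow (cat_of D) A B f = g"
  unfolding inverse_arrow_def
proof (rule the_equality)
  show "g \<in> Hom (cat_of D) B A \<and> Comp (cat_of D) g f = Idm (cat_of D) A \<and>
      Comp (cat_of D) f g = Idm (cat_of D) B"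
    using g gf fg by simp
next
  fix h assume "h \<in> Hom (cat_of D) B A \<and> Comp (cat_of D) h f = Idm (cat_of D) A \<and>
      Comp (cat_of D) f h = Idm (cat_of D) B"
  then have h: "h \<in> hom_set B A" and hf: "comp_arrow h f = id_arrow A"
    by auto
  have "h = comp_arrow h (comp_arrow f g)"
    using comp_arrow_id(2)[OF h \<open>finite B\<close>] fg by simp
  also have "\<dots> = comp_arrow (comp_arrow h f) g"
    by (rule comp_arrow_assoc[OF g f h])
  also have "\<dots> = g"
    using comp_arrow_id(1)[OF g \<open>finite A\<close>] hf by simp
  finally show "h = g" .
qed

lemma Node_in_tens_obj [simp]:
  "Node c i j \<in> tens_obj D A B \<longleftrightarrow> i \<in> A \<and> j \<in> B \<and> c \<in> fus D (lab i) (lab j)"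
  by (auto simp: tens_obj_def)

lemma tens_objE:
  assumes "x \<in> tens_obj D A B"
  obtains c i j where "x = Node c i j" "i \<in> A" "j \<in> B" "c \<in> fus D (lab i) (lab j)"
  using assms by (auto simp: tens_obj_def)

lemma lab_unit_summand [simp]: "lab (unit_summand D) = one D"
  by (simp add: unit_summand_def)

text \<open>Sums over all summands of a tensor product are reindexed by the one factor that can
  vary. The point \<open>h p\<close> may fail to be a summand, when the fusion rule forbids it; the
  term must then vanish there.\<close>

lemma sum_eq_sum_image:
  assumes "finite S" "inj_on h P" "\<And>p. p \<in> P \<Longrightarrow> h p \<notin> S \<Longrightarrow> g (h p) = 0"
    and "\<And>y. y \<in> S \<Longrightarrow> g y \<noteq> 0 \<Longrightarrow> y \<in> h ` P" "finite P"
  shows "(\<Sum>y\<in>S. g y) = (\<Sum>p\<in>P. g (h p))"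
proof -
  have "(\<Sum>y\<in>S. g y) = (\<Sum>y\<in>h ` P. g y)"
    by (rule sum.mono_neutral_cong) (use assms in auto)
  also have "\<dots> = (\<Sum>p\<in>P. g (h p))"
    using assms(2) by (simp add: sum.reindex)
  finally show ?thesis .
qed

text \<open>These axioms suffice for ideals and connectedness. \<open>Fsym_one\<close> is strictness
  of the unit in the first argument; it makes multiplication by an element of Hom(I, A) commute with
  multiplication from the right.\<close>

locale unital_fusion_data =
  fixes D :: "('l, 'k::field) fusion_data"
  assumes finite_fus: "\<And>a b. finite (fus D a b)"
    and one_simple: "one D \<in> simples D"
    and fus_one: "\<And>a. a \<in> simples D \<Longrightarrow> fus D (one D) a = {a}"
      "\<And>a. a \<in> simples D \<Longrightarrow> fus D a (one D) = {a}"
    and fus_commute: "\<And>a b. fus D a b = fus D b a"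
    and Fsym_one: "\<And>b c d e f. Fsym D (one D) b c d e f = 1"
begin

lemma finite_tens_obj: "finite A \<Longrightarrow> finite B \<Longrightarrow> finite (tens_obj D A B)"
proof -
  assume "finite A" "finite B"
  moreover have "tens_obj D A B =
      (\<Union>i\<in>A. \<Union>j\<in>B. (\<lambda>c. Node c i j) ` fus D (lab i) (lab j))"
    by (auto simp: tens_obj_def)
  ultimately show ?thesis
    using finite_fus by simp
qed

end

text \<open>The structure constants of an algebra: the coefficient of \<open>y\<close> in the product of \<open>i\<close> and \<open>j\<close>.\<close>

definition sconst :: "('l sobj, ('l, 'k) arrow) alg \<Rightarrow> 'l summand \<Rightarrow> 'l summand \<Rightarrow> 'l summand \<Rightarrow> 'k" where
  "sconst \<A> y i j = ent (mult \<A>) y (Node (lab y) i j)"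

definition ucoef :: "('l, 'k) fusion_data \<Rightarrow> ('l sobj, ('l, 'k) arrow) alg \<Rightarrow> 'l summand \<Rightarrow> 'k" where
  "ucoef D \<A> y = ent (unit \<A>) y (unit_summand D)"

section \<open>Algebra axioms in terms of structure constants\<close>

context unital_fusion_data
begin

text \<open>Both sides of an axiom are matrices, compared on each basis path. For associativity the
  column is \<open>Node (lab z) (Node e i j) k\<close>: on one side the inner product must land in a
  summand labelled \<open>e\<close>, on the other the associator spreads the path over the labels of
  \<open>q\<close> with coefficients \<open>Fsym\<close>.\<close>

lemma is_algebra_iff:
  "is_algebra (cat_of D) \<A> \<longleftrightarrow>
     finite (car \<A>) \<and> lab ` car \<A> \<subseteq> simples D \<and>
     mult \<A> \<in> hom_set (tens_obj D (car \<A>) (car \<A>)) (car \<A>) \<and>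
     unit \<A> \<in> hom_set {unit_summand D} (car \<A>) \<and>
     (\<forall>i\<in>car \<A>. \<forall>j\<in>car \<A>. \<forall>k\<in>car \<A>. \<forall>z\<in>car \<A>. \<forall>e\<in>fus D (lab i) (lab j). lab z \<in> fus D e (lab k) \<longrightarrow>
        (\<Sum>p | p \<in> car \<A> \<and> lab p = e. sconst \<A> z p k * sconst \<A> p i j) =
        (\<Sum>q\<in>car \<A>. Fsym D (lab i) (lab j) (lab k) (lab z) e (lab q) *
           (sconst \<A> z i q * sconst \<A> q j k))) \<and>
     (\<forall>x\<in>car \<A>. \<forall>y\<in>car \<A>. lab x = lab y \<longrightarrow>
        (\<Sum>q\<in>car \<A>. sconst \<A> y q x * ucoef D \<A> q) = of_bool (x = y)) \<and>
     (\<forall>x\<in>car \<A>. \<forall>y\<in>car \<A>. lab x = lab y \<longrightarrow>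
        (\<Sum>q\<in>car \<A>. sconst \<A> y x q * ucoef D \<A> q) = of_bool (x = y))"
proof -
  define A where "A = car \<A>"
  define \<mu> where "\<mu> = mult \<A>"
  define \<iota> where "\<iota> = unit \<A>"
  let ?U = "unit_summand D"
  note sc = sconst_def[of \<A>, folded \<mu>_def] ucoef_def[of D \<A>, folded \<iota>_def]
  have assoc: "comp_arrow \<mu> (tens_arrow D \<mu> (id_arrow A)) =
      comp_arrow \<mu> (comp_arrow (tens_arrow D (id_arrow A) \<mu>) (Assoc (cat_of D) A A A)) \<longleftrightarrow>
    (\<forall>i\<in>A. \<forall>j\<in>A. \<forall>k\<in>A. \<forall>z\<in>A. \<forall>e\<in>fus D (lab i) (lab j). lab z \<in> fus D e (lab k) \<longrightarrow>
        (\<Sum>p | p \<in> A \<and> lab p = e. sconst \<A> z p k * sconst \<A> p i j) =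
        (\<Sum>q\<in>A. Fsym D (lab i) (lab j) (lab k) (lab z) e (lab q) *
           (sconst \<A> z i q * sconst \<A> q j k)))"
    (is "?l = ?r \<longleftrightarrow> _")
    if fin: "finite A" and \<mu>: "\<mu> \<in> hom_set (tens_obj D A A) A"
  proof -
    note s = hom_setD(1,2)[OF \<mu>]
    note nz = hom_setD(3)[OF \<mu>]
    let ?A2 = "tens_obj D A A"
    have fin2: "finite ?A2" "finite (tens_obj D A ?A2)" "finite (tens_obj D ?A2 A)"
      using fin by (auto intro!: finite_tens_obj)
    have l: "?l \<in> hom_set (tens_obj D ?A2 A) A" and r: "?r \<in> hom_set (tens_obj D ?A2 A) A"
      using comp_arrow_in_hom_set[of \<mu>] by (metis s src_comp_arrow src_tens_arrow src_mk_arrow cat_of_simps(11))+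
    have L: "ent ?l z (Node (lab z) (Node e i j) k) =
        (\<Sum>p | p \<in> A \<and> lab p = e. sconst \<A> z p k * sconst \<A> p i j)"
      if "i \<in> A" "j \<in> A" "k \<in> A" "z \<in> A" "e \<in> fus D (lab i) (lab j)" "lab z \<in> fus D e (lab k)" for i j k z e
    proof -
      let ?x = "Node (lab z) (Node e i j) k"
      let ?T = "tens_arrow D \<mu> (id_arrow A)"
      have "ent ?l z ?x = (\<Sum>y\<in>?A2. ent \<mu> z y * ent ?T y ?x)"
        using that by (subst ent_comp_arrow) (simp add: s)
      also have "\<dots> = (\<Sum>p | p \<in> A \<and> lab p = e. ent \<mu> z (Node (lab z) p k) * ent ?T (Node (lab z) p k) ?x)"
      proof (rule sum_eq_sum_image)
        fix y assume y: "y \<in> ?A2" "ent \<mu> z y * ent ?T y ?x \<noteq> 0"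
        obtain c p k' where yy: "y = Node c p k'" "p \<in> A" "k' \<in> A" "c \<in> fus D (lab p) (lab k')"
          using y(1) by (rule tens_objE)
        have "c = lab z" "ent \<mu> p (Node e i j) \<noteq> 0" "k' = k"
          using y(2) yy by (auto simp: ent_tens_arrow s split: if_splits)
        then show "y \<in> (\<lambda>p. Node (lab z) p k) ` {p. p \<in> A \<and> lab p = e}"
          using yy nz by force
      qed (use fin fin2 that nz in \<open>force simp: inj_on_def\<close>)+
      also have "\<dots> = (\<Sum>p | p \<in> A \<and> lab p = e. sconst \<A> z p k * sconst \<A> p i j)"
        by (intro sum.cong refl) (use that in \<open>auto simp: ent_tens_arrow s sc\<close>)
      finally show ?thesis .
    qed
    have R: "ent ?r z (Node (lab z) (Node e i j) k) =
        (\<Sum>q\<in>A. Fsym D (lab i) (lab j) (lab k) (lab z) e (lab q) * (sconst \<A> z i q * sconst \<A> q j k))"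
      if as: "i \<in> A" "j \<in> A" "k \<in> A" "z \<in> A" "e \<in> fus D (lab i) (lab j)" "lab z \<in> fus D e (lab k)" for i j k z e
    proof -
      let ?x = "Node (lab z) (Node e i j) k"
      let ?T = "tens_arrow D (id_arrow A) \<mu>"
      let ?S = "comp_arrow ?T (Assoc (cat_of D) A A A)"
      \<comment> \<open>The associator fixes the leaf \<open>i\<close> and the total label, so only
        targets of the form \<open>Node (lab z) i q\<close> are reached.\<close>
      have S0: "ent ?S y ?x \<noteq> 0 \<Longrightarrow> y \<in> (\<lambda>q. Node (lab z) i q) ` A" if y: "y \<in> ?A2" for y
      proof -
        assume nz0: "ent ?S y ?x \<noteq> 0"
        obtain c p q where yy: "y = Node c p q" "p \<in> A" "q \<in> A" "c \<in> fus D (lab p) (lab q)"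
          using y by (rule tens_objE)
        have "c = lab z"
          using nz0 yy by (simp add: ent_comp_arrow split: if_splits)
        obtain w where w: "w \<in> tens_obj D A ?A2" "ent ?T y w \<noteq> 0" "assoc_ent D w ?x \<noteq> 0"
          using nz0 by (force simp: ent_comp_arrow split: if_splits elim: sum.not_neutral_contains_not_neutral)
        have "p = i"
          using w yy by (auto simp: ent_tens_arrow split: if_splits elim!: tens_objE)
        with yy \<open>c = lab z\<close> show ?thesis by auto
      qed
      have S1: "ent ?S (Node (lab z) i q) ?x = Fsym D (lab i) (lab j) (lab k) (lab z) e (lab q) * sconst \<A> q j k"
        if q: "q \<in> A" "lab z \<in> fus D (lab i) (lab q)" for q
      proof -
        have "ent ?S (Node (lab z) i q) ?x =
           (\<Sum>w\<in>tens_obj D A ?A2. ent ?T (Node (lab z) i q) w * assoc_ent D w ?x)"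
          using as q unfolding ent_comp_arrow
          by (auto simp: s ent_tens_arrow intro!: sum.cong)
        \<comment> \<open>One path contributes: the associator determines its leaves, and
          \<open>\<mu>\<close> preserves labels, so the inner label is \<open>lab q\<close>.\<close>
        also have "\<dots> = (\<Sum>w\<in>{Node (lab z) i (Node (lab q) j k)}. ent ?T (Node (lab z) i q) w * assoc_ent D w ?x)"
        proof (rule sum.mono_neutral_cong)
          fix w assume w: "w \<in> tens_obj D A ?A2 - {Node (lab z) i (Node (lab q) j k)}"
          obtain c p f j' k' where "w = Node c p (Node f j' k')"
            using w by (auto elim!: tens_objE)
          then show "ent ?T (Node (lab z) i q) w * assoc_ent D w ?x = 0"
            using w nz[of q "Node f j' k'"] by (auto simp: ent_tens_arrow split: if_splits)
        next
          fix w assume w: "w \<in> {Node (lab z) i (Node (lab q) j k)} - tens_obj D A ?A2"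
          then show "ent ?T (Node (lab z) i q) w * assoc_ent D w ?x = 0"
            using as q by (auto simp: ent_tens_arrow s)
        qed (use fin2 in auto)
        also have "\<dots> = Fsym D (lab i) (lab j) (lab k) (lab z) e (lab q) * sconst \<A> q j k"
          using as q nz[of q "Node (lab q) j k"] by (auto simp: ent_tens_arrow s sc)
        finally show ?thesis .
      qed
      have "ent ?r z ?x = (\<Sum>y\<in>?A2. ent \<mu> z y * ent ?S y ?x)"
        using that by (subst ent_comp_arrow) (simp add: s)
      also have "\<dots> = (\<Sum>q\<in>A. ent \<mu> z (Node (lab z) i q) * ent ?S (Node (lab z) i q) ?x)"
      proof (rule sum_eq_sum_image)
        fix y assume y: "y \<in> ?A2" "ent \<mu> z y * ent ?S y ?x \<noteq> 0"
        then show "y \<in> (\<lambda>q. Node (lab z) i q) ` A"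
          using S0 by auto
      qed (use fin fin2 that nz in \<open>force simp: inj_on_def\<close>)+
      also have "\<dots> = (\<Sum>q\<in>A. Fsym D (lab i) (lab j) (lab k) (lab z) e (lab q) * (sconst \<A> z i q * sconst \<A> q j k))"
      proof (rule sum.cong[OF refl])
        fix q assume "q \<in> A"
        then show "ent \<mu> z (Node (lab z) i q) * ent ?S (Node (lab z) i q) ?x =
          Fsym D (lab i) (lab j) (lab k) (lab z) e (lab q) * (sconst \<A> z i q * sconst \<A> q j k)"
          using S1[of q] nz[of z "Node (lab z) i q"] by (cases "ent \<mu> z (Node (lab z) i q) = 0") (auto simp: sc)
      qed
      finally show ?thesis .
    qed
    show ?thesis (is "_ \<longleftrightarrow> ?rhs")
    proof
      assume "?l = ?r"
      then show ?rhs using L R by auto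
    next
      assume rhs: ?rhs
      show "?l = ?r"
      proof (rule hom_set_eqI[OF l r])
        fix x z assume x: "x \<in> tens_obj D ?A2 A" "z \<in> A" "lab z = lab x"
        then obtain e i j k where "x = Node (lab z) (Node e i j) k" "i \<in> A" "j \<in> A" "k \<in> A"
            "e \<in> fus D (lab i) (lab j)" "lab z \<in> fus D e (lab k)"
          by (auto elim!: tens_objE)
        then show "ent ?l z x = ent ?r z x"
          using L R rhs x(2) by auto
      qed
    qed
  qed
  have lunit: "comp_arrow \<mu> (tens_arrow D \<iota> (id_arrow A)) = Lunit (cat_of D) A \<longleftrightarrow>
     (\<forall>x\<in>A. \<forall>y\<in>A. lab x = lab y \<longrightarrow> (\<Sum>q\<in>A. sconst \<A> y q x * ucoef D \<A> q) = of_bool (x = y))"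
    (is "?l = ?r \<longleftrightarrow> _")
    if fin: "finite A" and simp: "lab ` A \<subseteq> simples D"
      and \<mu>: "\<mu> \<in> hom_set (tens_obj D A A) A" and \<iota>: "\<iota> \<in> hom_set {?U} A"
  proof -
    note s = hom_setD(1,2)[OF \<mu>] hom_setD(1,2)[OF \<iota>]
    note nz = hom_setD(3)[OF \<mu>] and nz\<iota> = hom_setD(3)[OF \<iota>]
    have lr: "?l \<in> hom_set (tens_obj D {?U} A) A" "?r \<in> hom_set (tens_obj D {?U} A) A"
      using comp_arrow_in_hom_set[of \<mu> "tens_arrow D \<iota> (id_arrow A)"] by (simp_all add: s)
    have fus: "fus D (one D) (lab x) = {lab x}" if "x \<in> A" for x
      using that simp fus_one by auto
    have L: "ent ?l y (Node (lab y) ?U x) = (\<Sum>q\<in>A. sconst \<A> y q x * ucoef D \<A> q)"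
      if as: "x \<in> A" "y \<in> A" "lab x = lab y" for x y
    proof -
      let ?x = "Node (lab y) ?U x"
      let ?T = "tens_arrow D \<iota> (id_arrow A)"
      have "ent ?l y ?x = (\<Sum>w\<in>tens_obj D A A. ent \<mu> y w * ent ?T w ?x)"
        using that by (subst ent_comp_arrow) (simp add: s fus)
      also have "\<dots> = (\<Sum>q\<in>A. ent \<mu> y (Node (lab y) q x) * ent ?T (Node (lab y) q x) ?x)"
      proof (rule sum_eq_sum_image)
        fix w assume w: "w \<in> tens_obj D A A" "ent \<mu> y w * ent ?T w ?x \<noteq> 0"
        then show "w \<in> (\<lambda>q. Node (lab y) q x) ` A"
          by (auto simp: ent_tens_arrow s split: if_splits elim!: tens_objE)
      qed (use fin that nz finite_tens_obj in \<open>force simp: inj_on_def\<close>)+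
      also have "\<dots> = (\<Sum>q\<in>A. sconst \<A> y q x * ucoef D \<A> q)"
        using as fus nz[of y] by (intro sum.cong refl) (force simp: ent_tens_arrow s sc)
      finally show ?thesis .
    qed
    show ?thesis (is "_ \<longleftrightarrow> ?rhs")
    proof
      assume eq: "?l = ?r"
      show ?rhs
      proof (intro ballI impI)
        fix x y assume as: "x \<in> A" "y \<in> A" "lab x = lab y"
        show "(\<Sum>q\<in>A. sconst \<A> y q x * ucoef D \<A> q) = of_bool (x = y)"
          unfolding L[OF as, symmetric] eq using as by (simp add: fus)
      qed
    next
      assume rhs: ?rhs
      show "?l = ?r"
      proof (rule hom_set_eqI[OF lr])
        fix x y assume x: "x \<in> tens_obj D {?U} A" "y \<in> A" "lab y = lab x"
        then obtain x' where x': "x = Node (lab y) ?U x'" "x' \<in> A" "lab x' = lab y"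
          using fus by (auto elim!: tens_objE)
        then show "ent ?l y x = ent ?r y x"
          unfolding x'(1) using L[of x' y] rhs x(2) x'(2,3) by (auto simp: fus)
      qed
    qed
  qed
  have runit: "comp_arrow \<mu> (tens_arrow D (id_arrow A) \<iota>) = Runit (cat_of D) A \<longleftrightarrow>
     (\<forall>x\<in>A. \<forall>y\<in>A. lab x = lab y \<longrightarrow> (\<Sum>q\<in>A. sconst \<A> y x q * ucoef D \<A> q) = of_bool (x = y))"
    (is "?l = ?r \<longleftrightarrow> _")
    if fin: "finite A" and simp: "lab ` A \<subseteq> simples D"
      and \<mu>: "\<mu> \<in> hom_set (tens_obj D A A) A" and \<iota>: "\<iota> \<in> hom_set {?U} A"
  proof -
    note s = hom_setD(1,2)[OF \<mu>] hom_setD(1,2)[OF \<iota>]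
    note nz = hom_setD(3)[OF \<mu>] and nz\<iota> = hom_setD(3)[OF \<iota>]
    have lr: "?l \<in> hom_set (tens_obj D A {?U}) A" "?r \<in> hom_set (tens_obj D A {?U}) A"
      using comp_arrow_in_hom_set[of \<mu> "tens_arrow D (id_arrow A) \<iota>"] by (simp_all add: s)
    have fus: "fus D (lab x) (one D) = {lab x}" if "x \<in> A" for x
      using that simp fus_one by auto
    have L: "ent ?l y (Node (lab y) x ?U) = (\<Sum>q\<in>A. sconst \<A> y x q * ucoef D \<A> q)"
      if as: "x \<in> A" "y \<in> A" "lab x = lab y" for x y
    proof -
      let ?x = "Node (lab y) x ?U"
      let ?T = "tens_arrow D (id_arrow A) \<iota>"
      have "ent ?l y ?x = (\<Sum>w\<in>tens_obj D A A. ent \<mu> y w * ent ?T w ?x)"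
        using that by (subst ent_comp_arrow) (simp add: s fus)
      also have "\<dots> = (\<Sum>q\<in>A. ent \<mu> y (Node (lab y) x q) * ent ?T (Node (lab y) x q) ?x)"
      proof (rule sum_eq_sum_image)
        fix w assume w: "w \<in> tens_obj D A A" "ent \<mu> y w * ent ?T w ?x \<noteq> 0"
        then show "w \<in> (\<lambda>q. Node (lab y) x q) ` A"
          by (auto simp: ent_tens_arrow s split: if_splits elim!: tens_objE)
      qed (use fin that nz finite_tens_obj in \<open>force simp: inj_on_def\<close>)+
      also have "\<dots> = (\<Sum>q\<in>A. sconst \<A> y x q * ucoef D \<A> q)"
        using as fus nz[of y] by (intro sum.cong refl) (force simp: ent_tens_arrow s sc)
      finally show ?thesis .
    qed
    show ?thesis (is "_ \<longleftrightarrow> ?rhs")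
    proof
      assume eq: "?l = ?r"
      show ?rhs
      proof (intro ballI impI)
        fix x y assume as: "x \<in> A" "y \<in> A" "lab x = lab y"
        show "(\<Sum>q\<in>A. sconst \<A> y x q * ucoef D \<A> q) = of_bool (x = y)"
          unfolding L[OF as, symmetric] eq using as by (simp add: fus)
      qed
    next
      assume rhs: ?rhs
      show "?l = ?r"
      proof (rule hom_set_eqI[OF lr])
        fix x y assume x: "x \<in> tens_obj D A {?U}" "y \<in> A" "lab y = lab x"
        then obtain x' where x': "x = Node (lab y) x' ?U" "x' \<in> A" "lab x' = lab y"
          using fus by (auto elim!: tens_objE)
        then show "ent ?l y x = ent ?r y x"
          unfolding x'(1) using L[of x' y] rhs x(2) x'(2,3) by (auto simp: fus)
      qed
    qed
  qed
  show ?thesis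
    unfolding is_algebra_def Let_def cat_of_simps(1-8) A_def[symmetric] \<mu>_def[symmetric] \<iota>_def[symmetric]
    using assoc lunit runit by blast
qed

end

section \<open>Quotient algebras\<close>

text \<open>Greedy choice: a new index joins \<open>B\<close> exactly when its column lies outside
  the span of the columns already chosen. Choosing among the given columns matters, since the
  quotient object then consists of summands of \<open>A\<close> with their labels.\<close>

lemma column_basis:
  fixes N :: "'a \<Rightarrow> 'b \<Rightarrow> 'k::field"
  assumes "finite A"
  shows "\<exists>B f. B \<subseteq> A \<and> (\<forall>y. \<forall>x\<in>A. N y x = (\<Sum>b\<in>B. f b x * N y b)) \<and>
    (\<forall>c. (\<forall>y. (\<Sum>b\<in>B. c b * N y b) = 0) \<longrightarrow> (\<forall>b\<in>B. c b = 0))"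
  using assms
proof (induction A rule: finite_induct)
  case empty
  then show ?case by auto
next
  case (insert a A)
  then obtain B f where B: "B \<subseteq> A" and f: "\<And>y x. x \<in> A \<Longrightarrow> N y x = (\<Sum>b\<in>B. f b x * N y b)"
    and ind: "\<And>c b. \<forall>y. (\<Sum>b\<in>B. c b * N y b) = 0 \<Longrightarrow> b \<in> B \<Longrightarrow> c b = 0"
    by blast
  have finB: "finite B" and aB: "a \<notin> B"
    using B insert finite_subset by auto
  show ?case
  proof (cases "\<exists>g. \<forall>y. N y a = (\<Sum>b\<in>B. g b * N y b)")
    case True
    then obtain g where g: "\<And>y. N y a = (\<Sum>b\<in>B. g b * N y b)" by blast
    let ?f = "\<lambda>b x. if x = a then g b else f b x"
    have "N y x = (\<Sum>b\<in>B. ?f b x * N y b)" if "x \<in> insert a A" for y x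
      by (cases "x = a") (use that f g in simp_all)
    then show ?thesis
      using B ind by (intro exI[of _ B] exI[of _ ?f]) blast
  next
    case False
    let ?f = "\<lambda>b x. if x = a then of_bool (b = a) else if b = a then 0 else f b x"
    have "N y x = (\<Sum>b\<in>insert a B. ?f b x * N y b)" if "x \<in> insert a A" for y x
    proof (cases "x = a")
      case True
      have "(\<Sum>b\<in>B. of_bool (b = a) * N y b) = 0"
        by (intro sum.neutral) (use aB in auto)
      then show ?thesis
        using True finB aB by simp
    next
      case False
      have "(\<Sum>b\<in>B. (if b = a then 0 else f b x) * N y b) = (\<Sum>b\<in>B. f b x * N y b)"
        by (intro sum.cong) (use aB in auto)
      then show ?thesis
        using False finB aB that f by simp
    qed
    moreover have "c b = 0" if c: "\<forall>y. (\<Sum>b\<in>insert a B. c b * N y b) = 0" and b: "b \<in> insert a B" for c b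
    proof -
      have eq: "c a * N y a + (\<Sum>b\<in>B. c b * N y b) = 0" for y
        using c finB aB by simp
      have "c a = 0"
      proof (rule ccontr)
        assume nz: "c a \<noteq> 0"
        \<comment> \<open>A relation with a non-zero coefficient at \<open>a\<close> would put its
          column into the span of \<open>B\<close>.\<close>
        have "N y a = (\<Sum>b\<in>B. - (c b / c a) * N y b)" for y
        proof -
          have "N y a = - (\<Sum>b\<in>B. c b * N y b) / c a"
            using eq[of y] nz by (simp add: field_simps add_eq_0_iff2)
          also have "\<dots> = (\<Sum>b\<in>B. - (c b / c a) * N y b)"
            by (simp add: sum_divide_distrib sum_negf)
          finally show ?thesis .
        qed
        with spec[OF False[unfolded not_ex], of "\<lambda>b. - (c b / c a)"] show False by blast
      qed
      then show ?thesis
        using eq ind[of c] b by auto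
    qed
    moreover have "insert a B \<subseteq> insert a A"
      using B by auto
    ultimately show ?thesis
      by (intro exI[of _ "insert a B"] exI[of _ ?f]) blast
  qed
qed

context unital_fusion_data
begin

text \<open>Besides unpacking the axioms this frees the unit laws from the label condition: for
  different labels no product of \<open>x\<close> with a unit summand reaches \<open>y\<close>, and
  both sides are 0.\<close>

lemma algebraD:
  assumes "is_algebra (cat_of D) \<A>"
  shows "finite (car \<A>)" "\<And>i. i \<in> car \<A> \<Longrightarrow> lab i \<in> simples D"
    "mult \<A> \<in> hom_set (tens_obj D (car \<A>) (car \<A>)) (car \<A>)"
    "unit \<A> \<in> hom_set {unit_summand D} (car \<A>)"
    "\<And>i j k z e. i\<in>car \<A> \<Longrightarrow> j\<in>car \<A> \<Longrightarrow> k\<in>car \<A> \<Longrightarrow> z\<in>car \<A> \<Longrightarrow>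
        e\<in>fus D (lab i) (lab j) \<Longrightarrow> lab z \<in> fus D e (lab k) \<Longrightarrow>
        (\<Sum>p | p \<in> car \<A> \<and> lab p = e. sconst \<A> z p k * sconst \<A> p i j) =
        (\<Sum>q\<in>car \<A>. Fsym D (lab i) (lab j) (lab k) (lab z) e (lab q) *
           (sconst \<A> z i q * sconst \<A> q j k))"
    "\<And>x y. x\<in>car \<A> \<Longrightarrow> y\<in>car \<A> \<Longrightarrow>
        (\<Sum>q\<in>car \<A>. sconst \<A> y q x * ucoef D \<A> q) = of_bool (x = y)"
    "\<And>x y. x\<in>car \<A> \<Longrightarrow> y\<in>car \<A> \<Longrightarrow>
        (\<Sum>q\<in>car \<A>. sconst \<A> y x q * ucoef D \<A> q) = of_bool (x = y)"
    "\<And>y i j. sconst \<A> y i j \<noteq> 0 \<Longrightarrow> i \<in> car \<A> \<and> j \<in> car \<A> \<and> y \<in> car \<A> \<and> lab y \<in> fus D (lab i) (lab j)"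
    "\<And>y. ucoef D \<A> y \<noteq> 0 \<Longrightarrow> y \<in> car \<A> \<and> lab y = one D"
proof -
  note A = assms[unfolded is_algebra_iff]
  show "finite (car \<A>)" "mult \<A> \<in> hom_set (tens_obj D (car \<A>) (car \<A>)) (car \<A>)"
    "unit \<A> \<in> hom_set {unit_summand D} (car \<A>)"
    using A by blast+
  show simp: "lab i \<in> simples D" if "i \<in> car \<A>" for i
    using A that by blast
  show "\<And>i j k z e. i\<in>car \<A> \<Longrightarrow> j\<in>car \<A> \<Longrightarrow> k\<in>car \<A> \<Longrightarrow> z\<in>car \<A> \<Longrightarrow>
        e\<in>fus D (lab i) (lab j) \<Longrightarrow> lab z \<in> fus D e (lab k) \<Longrightarrow>
        (\<Sum>p | p \<in> car \<A> \<and> lab p = e. sconst \<A> z p k * sconst \<A> p i j) =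
        (\<Sum>q\<in>car \<A>. Fsym D (lab i) (lab j) (lab k) (lab z) e (lab q) *
           (sconst \<A> z i q * sconst \<A> q j k))"
    using A by blast
  show nz: "i \<in> car \<A> \<and> j \<in> car \<A> \<and> y \<in> car \<A> \<and> lab y \<in> fus D (lab i) (lab j)"
    if "sconst \<A> y i j \<noteq> 0" for y i j
  proof -
    have "mult \<A> \<in> hom_set (tens_obj D (car \<A>) (car \<A>)) (car \<A>)"
      using A by blast
    from hom_setD(3)[OF this that[unfolded sconst_def]] show ?thesis by simp
  qed
  show nzu: "y \<in> car \<A> \<and> lab y = one D" if "ucoef D \<A> y \<noteq> 0" for y
  proof -
    have "unit \<A> \<in> hom_set {unit_summand D} (car \<A>)"
      using A by blast
    from hom_setD(3)[OF this that[unfolded ucoef_def]] show ?thesis by simp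
  qed
  show "(\<Sum>q\<in>car \<A>. sconst \<A> y q x * ucoef D \<A> q) = of_bool (x = y)"
    if "x\<in>car \<A>" "y\<in>car \<A>" for x y
  proof (cases "lab x = lab y")
    case True
    then show ?thesis using A that by blast
  next
    case False
    have "sconst \<A> y q x * ucoef D \<A> q = 0" for q
      using nz[of y q x] nzu[of q] False fus_one(1)[OF simp[OF that(1)]] by fastforce
    with False show ?thesis by (auto intro: sum.neutral)
  qed
  show "(\<Sum>q\<in>car \<A>. sconst \<A> y x q * ucoef D \<A> q) = of_bool (x = y)"
    if "x\<in>car \<A>" "y\<in>car \<A>" for x y
  proof (cases "lab x = lab y")
    case True
    then show ?thesis using A that by blast
  next
    case False
    have "sconst \<A> y x q * ucoef D \<A> q = 0" for q
      using nz[of y x q] nzu[of q] False fus_one(2)[OF simp[OF that(1)]] by fastforce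
    with False show ?thesis by (auto intro: sum.neutral)
  qed
qed

text \<open>
  The kernel of an endomorphism \<open>N\<close> of the bimodule \<open>A\<close> is an ideal. The quotient is realised
  on a set \<open>B\<close> of summands indexing a basis of the column space of \<open>N\<close>; the projection
  expresses every column in this basis.
\<close>

lemma quotient_algebra:
  fixes N :: "'l summand \<Rightarrow> 'l summand \<Rightarrow> 'k"
  assumes alg: "is_algebra (cat_of D) \<A>"
    and N: "\<And>y x. N y x \<noteq> 0 \<Longrightarrow> y \<in> car \<A> \<and> x \<in> car \<A> \<and> lab y = lab x"
    and left: "\<And>y x j. y \<in> car \<A> \<Longrightarrow> x \<in> car \<A> \<Longrightarrow> j \<in> car \<A> \<Longrightarrow>
       (\<Sum>x'\<in>car \<A>. sconst \<A> y x' j * N x' x) = (\<Sum>y'\<in>car \<A>. N y y' * sconst \<A> y' x j)"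
    and right: "\<And>y x j. y \<in> car \<A> \<Longrightarrow> x \<in> car \<A> \<Longrightarrow> j \<in> car \<A> \<Longrightarrow>
       (\<Sum>x'\<in>car \<A>. sconst \<A> y j x' * N x' x) = (\<Sum>y'\<in>car \<A>. N y y' * sconst \<A> y' j x)"
  obtains \<B> f where "is_algebra (cat_of D) \<B>" "alg_hom (cat_of D) \<A> \<B> f"
    "\<forall>v. (\<forall>y. (\<Sum>x\<in>car \<A>. N y x * v x) = 0) \<longrightarrow> (\<forall>b. (\<Sum>x\<in>car \<A>. ent f b x * v x) = 0)"
    "f = Zero (cat_of D) (car \<A>) (car \<B>) \<longrightarrow> N = (\<lambda>y x. 0)"
proof -
  note A = algebraD[OF alg]
  let ?A = "car \<A>"
  let ?m = "sconst \<A>" and ?U = "unit_summand D"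
  obtain B f0 where B: "B \<subseteq> ?A" and f0: "\<And>y x. x \<in> ?A \<Longrightarrow> N y x = (\<Sum>b\<in>B. f0 b x * N y b)"
    and ind: "\<And>c b. \<forall>y. (\<Sum>b\<in>B. c b * N y b) = 0 \<Longrightarrow> b \<in> B \<Longrightarrow> c b = 0"
    using column_basis[OF A(1), of N] by blast
  have finB: "finite B"
    using B A(1) finite_subset by auto
  \<comment> \<open>Coefficients between different labels are cut off so that \<open>f\<close> is a
    morphism. As \<open>N\<close> preserves labels, the expansion of its columns survives.\<close>
  define f where "f b x = (if b \<in> B \<and> x \<in> ?A \<and> lab b = lab x then f0 b x else 0)" for b x
  have f: "N y x = (\<Sum>b\<in>B. N y b * f b x)" if x: "x \<in> ?A" for y x
  proof (cases "lab y = lab x")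
    case True
    have "f0 b x * N y b = N y b * f b x" if "b \<in> B" for b
      using True x that N[of y b] by (cases "N y b = 0") (auto simp: f_def)
    then show ?thesis
      unfolding f0[OF x] by (rule sum.cong[OF refl])
  next
    case False
    then have "N y b * f b x = 0" for b
      using N[of y b] by (cases "N y b = 0") (auto simp: f_def)
    then have "(\<Sum>b\<in>B. N y b * f b x) = 0"
      by (intro sum.neutral) blast
    then show ?thesis
      using False N[of y x] by metis
  qed
  \<comment> \<open>The columns indexed by \<open>B\<close> are independent, so \<open>N\<close>
    restricted to \<open>B\<close> can be cancelled on the left.\<close>
  have ind2: "c b = c' b" if "\<And>y. (\<Sum>b\<in>B. N y b * c b) = (\<Sum>b\<in>B. N y b * c' b)" "b \<in> B" for c c' :: "'l summand \<Rightarrow> 'k" and b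
  proof -
    have "\<forall>y. (\<Sum>b\<in>B. (c b - c' b) * N y b) = 0"
      using that(1) by (simp add: algebra_simps sum_subtractf)
    from ind[OF this that(2)] show ?thesis by simp
  qed
  have fB: "f b b' = of_bool (b = b')" if b: "b \<in> B" "b' \<in> B" for b b'
  proof (rule ind2[OF _ b(1)])
    fix y
    have "(\<Sum>b\<in>B. N y b * of_bool (b = b')) = (\<Sum>b\<in>B. if b = b' then N y b else 0)"
      by (intro sum.cong) auto
    also have "\<dots> = N y b'"
      using b finB by simp
    also have "\<dots> = (\<Sum>b\<in>B. N y b * f b b')"
      using f b B by blast
    finally show "(\<Sum>b\<in>B. N y b * f b b') = (\<Sum>b\<in>B. N y b * of_bool (b = b'))" ..
  qed
  have Nf: "(\<Sum>y'\<in>?A. N y y' * g y') = (\<Sum>b\<in>B. N y b * (\<Sum>y'\<in>?A. f b y' * g y'))" for y g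
  proof -
    have "(\<Sum>y'\<in>?A. N y y' * g y') = (\<Sum>y'\<in>?A. \<Sum>b\<in>B. N y b * f b y' * g y')"
      by (intro sum.cong refl) (simp add: f sum_distrib_right)
    also have "\<dots> = (\<Sum>b\<in>B. \<Sum>y'\<in>?A. N y b * f b y' * g y')"
      by (rule sum.swap)
    finally show ?thesis
      by (simp add: sum_distrib_left mult.assoc)
  qed
  \<comment> \<open>\<open>N\<close> is its injective restriction to \<open>B\<close> after
    \<open>f\<close>; hence \<open>f\<close> identifies whatever \<open>N\<close>
    identifies.\<close>
  have ind3: "(\<Sum>y'\<in>?A. f b y' * g y') = (\<Sum>y'\<in>?A. f b y' * h y')"
    if "\<And>y. y \<in> ?A \<Longrightarrow> (\<Sum>y'\<in>?A. N y y' * g y') = (\<Sum>y'\<in>?A. N y y' * h y')" "b \<in> B" for g h b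
  proof (rule ind2[OF _ that(2)])
    fix y
    show "(\<Sum>b\<in>B. N y b * (\<Sum>y'\<in>?A. f b y' * g y')) = (\<Sum>b\<in>B. N y b * (\<Sum>y'\<in>?A. f b y' * h y'))"
      unfolding Nf[symmetric]
    proof (cases "y \<in> ?A")
      case False
      then have "N y y' = 0" for y' using N[of y y'] by auto
      then show "(\<Sum>y'\<in>?A. N y y' * g y') = (\<Sum>y'\<in>?A. N y y' * h y')" by simp
    qed (use that in auto)
  qed
  define fm where "fm y i j = (\<Sum>z\<in>?A. f y z * ?m z i j)" for y i j
  have fm_nz: "y \<in> B \<and> i \<in> ?A \<and> j \<in> ?A \<and> lab y \<in> fus D (lab i) (lab j)" if nz: "fm y i j \<noteq> 0" for y i j
  proof -
    obtain z where "f y z * ?m z i j \<noteq> 0"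
      using nz unfolding fm_def by (rule sum.not_neutral_contains_not_neutral)
    then have "f y z \<noteq> 0" "?m z i j \<noteq> 0" by auto
    then show ?thesis using A(8)[of z i j] by (auto simp: f_def split: if_splits)
  qed
  \<comment> \<open>Well-definedness in the left factor: replacing \<open>x\<close> by its
    representative in the span of \<open>B\<close> does not change the projected product, because
    \<open>N\<close> commutes with right multiplication by \<open>j\<close>.\<close>
  have P1: "(\<Sum>b\<in>B. f b x * fm y b j) = fm y x j" if as: "x \<in> ?A" "j \<in> ?A" "y \<in> B" for x j y
  proof -
    have "(\<Sum>b\<in>B. f b x * fm y b j) = (\<Sum>z\<in>?A. f y z * (\<Sum>b\<in>B. f b x * ?m z b j))"
      unfolding fm_def sum_distrib_left by (subst sum.swap) (simp add: mult.left_commute)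
    also have "\<dots> = (\<Sum>z\<in>?A. f y z * ?m z x j)"
    proof (rule ind3[OF _ as(3)])
      fix w assume w: "w \<in> ?A"
      have "(\<Sum>z\<in>?A. N w z * (\<Sum>b\<in>B. f b x * ?m z b j)) = (\<Sum>b\<in>B. f b x * (\<Sum>z\<in>?A. N w z * ?m z b j))"
        unfolding sum_distrib_left by (subst sum.swap) (simp add: mult.left_commute)
      also have "\<dots> = (\<Sum>b\<in>B. f b x * (\<Sum>z\<in>?A. ?m w z j * N z b))"
        by (intro sum.cong refl) (use left w as B in \<open>auto simp: subset_iff\<close>)
      also have "\<dots> = (\<Sum>z\<in>?A. ?m w z j * (\<Sum>b\<in>B. N z b * f b x))"
        unfolding sum_distrib_left by (subst sum.swap) (simp add: mult_ac)
      also have "\<dots> = (\<Sum>z\<in>?A. ?m w z j * N z x)"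
        using f as by simp
      also have "\<dots> = (\<Sum>z\<in>?A. N w z * ?m z x j)"
        using left w as by simp
      finally show "(\<Sum>z\<in>?A. N w z * (\<Sum>b\<in>B. f b x * ?m z b j)) = (\<Sum>z\<in>?A. N w z * ?m z x j)" .
    qed
    finally show ?thesis by (simp add: fm_def)
  qed
  \<comment> \<open>The mirror image, since \<open>N\<close> also commutes with left multiplication
    by \<open>j\<close>.\<close>
  have P2: "(\<Sum>b\<in>B. f b x * fm y j b) = fm y j x" if as: "x \<in> ?A" "j \<in> ?A" "y \<in> B" for x j y
  proof -
    have "(\<Sum>b\<in>B. f b x * fm y j b) = (\<Sum>z\<in>?A. f y z * (\<Sum>b\<in>B. f b x * ?m z j b))"
      unfolding fm_def sum_distrib_left by (subst sum.swap) (simp add: mult.left_commute)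
    also have "\<dots> = (\<Sum>z\<in>?A. f y z * ?m z j x)"
    proof (rule ind3[OF _ as(3)])
      fix w assume w: "w \<in> ?A"
      have "(\<Sum>z\<in>?A. N w z * (\<Sum>b\<in>B. f b x * ?m z j b)) = (\<Sum>b\<in>B. f b x * (\<Sum>z\<in>?A. N w z * ?m z j b))"
        unfolding sum_distrib_left by (subst sum.swap) (simp add: mult.left_commute)
      also have "\<dots> = (\<Sum>b\<in>B. f b x * (\<Sum>z\<in>?A. ?m w j z * N z b))"
        by (intro sum.cong refl) (use right w as B in \<open>auto simp: subset_iff\<close>)
      also have "\<dots> = (\<Sum>z\<in>?A. ?m w j z * (\<Sum>b\<in>B. N z b * f b x))"
        unfolding sum_distrib_left by (subst sum.swap) (simp add: mult_ac)
      also have "\<dots> = (\<Sum>z\<in>?A. ?m w j z * N z x)"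
        using f as by simp
      also have "\<dots> = (\<Sum>z\<in>?A. N w z * ?m z j x)"
        using right w as by simp
      finally show "(\<Sum>z\<in>?A. N w z * (\<Sum>b\<in>B. f b x * ?m z j b)) = (\<Sum>z\<in>?A. N w z * ?m z j x)" .
    qed
    finally show ?thesis by (simp add: fm_def)
  qed
  define F where "F = mk_arrow ?A B f"
  have entF: "ent F b x = f b x" for b x
    by (auto simp: F_def f_def)
  \<comment> \<open>The elements of \<open>B\<close> are summands of \<open>A\<close>, so they are
    multiplied in \<open>A\<close> and the result is projected back.\<close>
  define \<B> where "\<B> = \<lparr>car = B,
      mult = mk_arrow (tens_obj D B B) B (\<lambda>y x. \<Sum>z\<in>?A. f y z * ent (mult \<A>) z x),
      unit = comp_arrow F (unit \<A>)\<rparr>"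
  have \<B> [simp]: "car \<B> = B" by (simp add: \<B>_def)
  have mA: "?m z i j = ent (mult \<A>) z (Node (lab z) i j)" for z i j
    by (simp add: sconst_def)
  have mB: "sconst \<B> y i j = fm y i j" if "i \<in> B" "j \<in> B" "y \<in> B" for y i j
  proof (cases "lab y \<in> fus D (lab i) (lab j)")
    case True
    then show ?thesis
      using that by (auto simp: \<B>_def sconst_def fm_def f_def intro!: sum.cong)
  next
    case False
    then show ?thesis
      using that fm_nz[of y i j] by (auto simp: \<B>_def sconst_def)
  qed
  have uB: "ucoef D \<B> y = (\<Sum>z\<in>?A. f y z * ucoef D \<A> z)" if "y \<in> B" for y
  proof (cases "lab y = one D")
    case True
    then show ?thesis
      using that hom_setD(1,2)[OF A(4)]
      by (simp add: \<B>_def ucoef_def ent_comp_arrow F_def f_def cong: if_cong)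
  next
    case False
    then have "f y z * ucoef D \<A> z = 0" for z
      using A(9)[of z] by (auto simp: f_def)
    then have "(\<Sum>z\<in>?A. f y z * ucoef D \<A> z) = 0"
      by (intro sum.neutral) blast
    then show ?thesis
      using False that by (simp add: \<B>_def ucoef_def ent_comp_arrow)
  qed
  have BA: "b \<in> B \<Longrightarrow> b \<in> ?A" for b using B by auto
  have algB: "is_algebra (cat_of D) \<B>"
    unfolding is_algebra_iff \<B>
  proof (intro conjI ballI impI)
    show "finite B" by fact
    show "lab ` B \<subseteq> simples D"
      using A(2) B by auto
    show "mult \<B> \<in> hom_set (tens_obj D B B) B"
      by (simp add: \<B>_def)
    show "unit \<B> \<in> hom_set {unit_summand D} B"
      using comp_arrow_in_hom_set[of F "unit \<A>"] hom_setD(1)[OF A(4)] by (simp add: \<B>_def F_def)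
  next
    fix i j k z e
    assume as: "i \<in> B" "j \<in> B" "k \<in> B" "z \<in> B" "e \<in> fus D (lab i) (lab j)" "lab z \<in> fus D e (lab k)"
    let ?F = "\<lambda>q. Fsym D (lab i) (lab j) (lab k) (lab z) e (lab q)"
    have "(\<Sum>p | p \<in> B \<and> lab p = e. sconst \<B> z p k * sconst \<B> p i j) =
        (\<Sum>p\<in>B. \<Sum>w | w \<in> ?A \<and> lab w = e. fm z p k * (f p w * ?m w i j))"
    proof (rule sum.mono_neutral_cong_left)
      show "\<forall>p\<in>B - {p \<in> B. lab p = e}. (\<Sum>w | w \<in> ?A \<and> lab w = e. fm z p k * (f p w * ?m w i j)) = 0"
        by (auto simp: f_def intro!: sum.neutral)
      fix p assume p: "p \<in> {p \<in> B. lab p = e}"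
      have "fm p i j = (\<Sum>w | w \<in> ?A \<and> lab w = e. f p w * ?m w i j)"
        unfolding fm_def by (rule sum.mono_neutral_right) (use A(1) p in \<open>auto simp: f_def\<close>)
      then show "sconst \<B> z p k * sconst \<B> p i j = (\<Sum>w | w \<in> ?A \<and> lab w = e. fm z p k * (f p w * ?m w i j))"
        using p as by (simp add: mB sum_distrib_left)
    qed (use finB in auto)
    also have "\<dots> = (\<Sum>w | w \<in> ?A \<and> lab w = e. (\<Sum>p\<in>B. f p w * fm z p k) * ?m w i j)"
      unfolding sum_distrib_right by (subst sum.swap) (simp add: mult_ac)
    \<comment> \<open>\<open>P1\<close> removes the inner projection. Associativity of
      \<open>A\<close> applies to what remains, and \<open>P2\<close> reinserts a projection on the
      other side.\<close>
    also have "\<dots> = (\<Sum>w | w \<in> ?A \<and> lab w = e. fm z w k * ?m w i j)"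
      by (intro sum.cong refl) (use P1 as BA in auto)
    also have "\<dots> = (\<Sum>w | w \<in> ?A \<and> lab w = e. \<Sum>y\<in>?A. f z y * (?m y w k * ?m w i j))"
      by (simp add: fm_def sum_distrib_right mult.assoc)
    also have "\<dots> = (\<Sum>y\<in>?A. \<Sum>w | w \<in> ?A \<and> lab w = e. f z y * (?m y w k * ?m w i j))"
      by (rule sum.swap)
    also have "\<dots> = (\<Sum>y\<in>?A. f z y * (\<Sum>w | w \<in> ?A \<and> lab w = e. ?m y w k * ?m w i j))"
      by (simp add: sum_distrib_left)
    also have "\<dots> = (\<Sum>y\<in>?A. f z y * (\<Sum>q\<in>?A. ?F q * (?m y i q * ?m q j k)))"
    proof (rule sum.cong[OF refl])
      fix y assume y: "y \<in> ?A"
      show "f z y * (\<Sum>w | w \<in> ?A \<and> lab w = e. ?m y w k * ?m w i j) =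
          f z y * (\<Sum>q\<in>?A. ?F q * (?m y i q * ?m q j k))"
      proof (cases "f z y = 0")
        case False
        then have "lab z = lab y" by (auto simp: f_def split: if_splits)
        then show ?thesis
          using A(5)[of i j k y e] as y BA by simp
      qed simp
    qed
    also have "\<dots> = (\<Sum>y\<in>?A. \<Sum>q\<in>?A. ?F q * ?m q j k * (f z y * ?m y i q))"
      by (simp add: sum_distrib_left mult_ac)
    also have "\<dots> = (\<Sum>q\<in>?A. \<Sum>y\<in>?A. ?F q * ?m q j k * (f z y * ?m y i q))"
      by (rule sum.swap)
    also have "\<dots> = (\<Sum>q\<in>?A. ?F q * ?m q j k * fm z i q)"
      by (simp add: fm_def sum_distrib_left)
    also have "\<dots> = (\<Sum>q\<in>?A. ?F q * ?m q j k * (\<Sum>b\<in>B. f b q * fm z i b))"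
      by (intro sum.cong refl) (use P2 as BA in auto)
    also have "\<dots> = (\<Sum>q\<in>?A. \<Sum>b\<in>B. ?F b * (fm z i b * (f b q * ?m q j k)))"
      unfolding sum_distrib_left by (intro sum.cong refl) (auto simp: f_def)
    also have "\<dots> = (\<Sum>b\<in>B. \<Sum>q\<in>?A. ?F b * (fm z i b * (f b q * ?m q j k)))"
      by (rule sum.swap)
    also have "\<dots> = (\<Sum>b\<in>B. ?F b * (fm z i b * fm b j k))"
      by (simp add: fm_def sum_distrib_left)
    also have "\<dots> = (\<Sum>q\<in>B. ?F q * (sconst \<B> z i q * sconst \<B> q j k))"
      using as by (simp add: mB)
    finally show "(\<Sum>p | p \<in> B \<and> lab p = e. sconst \<B> z p k * sconst \<B> p i j) =
       (\<Sum>q\<in>B. ?F q * (sconst \<B> z i q * sconst \<B> q j k))" .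
  next
    fix x y assume as: "x \<in> B" "y \<in> B" "lab x = lab y"
    have "(\<Sum>q\<in>B. sconst \<B> y q x * ucoef D \<B> q) = (\<Sum>q\<in>B. \<Sum>z\<in>?A. f q z * fm y q x * ucoef D \<A> z)"
      using as by (simp add: mB uB sum_distrib_left mult_ac)
    also have "\<dots> = (\<Sum>z\<in>?A. (\<Sum>q\<in>B. f q z * fm y q x) * ucoef D \<A> z)"
      by (subst sum.swap) (simp add: sum_distrib_right)
    also have "\<dots> = (\<Sum>z\<in>?A. fm y z x * ucoef D \<A> z)"
      by (intro sum.cong refl) (use P1 as BA in auto)
    also have "\<dots> = (\<Sum>w\<in>?A. f y w * (\<Sum>z\<in>?A. ?m w z x * ucoef D \<A> z))"
      unfolding fm_def sum_distrib_left sum_distrib_right by (subst sum.swap) (simp add: mult_ac)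
    also have "\<dots> = (\<Sum>w\<in>?A. if w = x then f y w else 0)"
      by (intro sum.cong refl) (use as BA A(6) in auto)
    also have "\<dots> = of_bool (x = y)"
      using A(1) as BA fB by auto
    finally show "(\<Sum>q\<in>B. sconst \<B> y q x * ucoef D \<B> q) = of_bool (x = y)" .
  next
    fix x y assume as: "x \<in> B" "y \<in> B" "lab x = lab y"
    have "(\<Sum>q\<in>B. sconst \<B> y x q * ucoef D \<B> q) = (\<Sum>q\<in>B. \<Sum>z\<in>?A. f q z * fm y x q * ucoef D \<A> z)"
      using as by (simp add: mB uB sum_distrib_left mult_ac)
    also have "\<dots> = (\<Sum>z\<in>?A. (\<Sum>q\<in>B. f q z * fm y x q) * ucoef D \<A> z)"
      by (subst sum.swap) (simp add: sum_distrib_right)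
    also have "\<dots> = (\<Sum>z\<in>?A. fm y x z * ucoef D \<A> z)"
      by (intro sum.cong refl) (use P2 as BA in auto)
    also have "\<dots> = (\<Sum>w\<in>?A. f y w * (\<Sum>z\<in>?A. ?m w x z * ucoef D \<A> z))"
      unfolding fm_def sum_distrib_left sum_distrib_right by (subst sum.swap) (simp add: mult_ac)
    also have "\<dots> = (\<Sum>w\<in>?A. if w = x then f y w else 0)"
      by (intro sum.cong refl) (use as BA A(7) in auto)
    also have "\<dots> = of_bool (x = y)"
      using A(1) as BA fB by auto
    finally show "(\<Sum>q\<in>B. sconst \<B> y x q * ucoef D \<B> q) = of_bool (x = y)" .
  qed
  have sF: "src F = ?A" "tgt F = B" by (simp_all add: F_def)
  have sm: "src (mult \<A>) = tens_obj D ?A ?A" "tgt (mult \<A>) = ?A"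
    using hom_setD(1,2)[OF A(3)] .
  have "comp_arrow F (mult \<A>) = comp_arrow (mult \<B>) (tens_arrow D F F)"
  proof (rule hom_set_eqI)
    show "comp_arrow F (mult \<A>) \<in> hom_set (tens_obj D ?A ?A) B"
      using comp_arrow_in_hom_set[of F "mult \<A>"] by (simp add: sF sm)
    show "comp_arrow (mult \<B>) (tens_arrow D F F) \<in> hom_set (tens_obj D ?A ?A) B"
      using comp_arrow_in_hom_set[of "mult \<B>" "tens_arrow D F F"] by (simp add: sF \<B>_def)
    fix x y assume x: "x \<in> tens_obj D ?A ?A" and y: "y \<in> B" and l: "lab y = lab x"
    then obtain i j where xx: "x = Node (lab y) i j" "i \<in> ?A" "j \<in> ?A" "lab y \<in> fus D (lab i) (lab j)"
      by (auto elim!: tens_objE)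
    have "ent (comp_arrow F (mult \<A>)) y x = (\<Sum>z\<in>?A. f y z * ent (mult \<A>) z x)"
      using x y l by (simp add: ent_comp_arrow sF sm entF)
    also have "\<dots> = fm y i j"
      unfolding fm_def xx(1) by (intro sum.cong refl) (simp add: f_def sconst_def)
    \<comment> \<open>The projection is multiplicative because the left factor and then the right
      one may be replaced by representatives in the span of \<open>B\<close>.\<close>
    also have "\<dots> = (\<Sum>b\<in>B. f b i * fm y b j)"
      using P1 xx y by simp
    also have "\<dots> = (\<Sum>b\<in>B. f b i * (\<Sum>b'\<in>B. f b' j * fm y b b'))"
      by (intro sum.cong refl) (use P2 xx y BA in auto)
    also have "\<dots> = (\<Sum>(b, b')\<in>B \<times> B. sconst \<B> y b b' * (f b i * f b' j))"
      unfolding sum.cartesian_product[symmetric] sum_distrib_left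
      by (intro sum.cong refl) (use y in \<open>auto simp: mB\<close>)
    also have "\<dots> = (\<Sum>p\<in>B \<times> B. ent (mult \<B>) y (Node (lab y) (fst p) (snd p)) *
        ent (tens_arrow D F F) (Node (lab y) (fst p) (snd p)) x)"
    proof (intro sum.cong refl, clarify)
      fix b b' assume b: "b \<in> B" "b' \<in> B"
      show "sconst \<B> y b b' * (f b i * f b' j) = ent (mult \<B>) y (Node (lab y) (fst (b, b')) (snd (b, b'))) *
        ent (tens_arrow D F F) (Node (lab y) (fst (b, b')) (snd (b, b'))) x"
        using b xx(2,3,4) algebraD(8)[OF algB, of y b b'] unfolding xx(1)
        by (cases "sconst \<B> y b b' = 0") (auto simp: sconst_def ent_tens_arrow sF entF)
    qed
    also have "\<dots> = (\<Sum>w\<in>tens_obj D B B. ent (mult \<B>) y w * ent (tens_arrow D F F) w x)"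
    proof (rule sum_eq_sum_image[symmetric])
      fix w assume w: "w \<in> tens_obj D B B" "ent (mult \<B>) y w * ent (tens_arrow D F F) w x \<noteq> 0"
      obtain c b b' where ww: "w = Node c b b'" "b \<in> B" "b' \<in> B"
        using w(1) by (auto elim!: tens_objE)
      have "c = lab y"
        using w(2) ww l by (auto simp: ent_tens_arrow split: if_splits)
      then show "w \<in> (\<lambda>p. Node (lab y) (fst p) (snd p)) ` (B \<times> B)"
        using ww by force
    next
      fix p assume "Node (lab y) (fst p) (snd p) \<notin> tens_obj D B B"
      then show "ent (mult \<B>) y (Node (lab y) (fst p) (snd p)) *
        ent (tens_arrow D F F) (Node (lab y) (fst p) (snd p)) x = 0"
        by (auto simp: ent_tens_arrow sF)
    qed (use finB finite_tens_obj in \<open>auto simp: inj_on_def\<close>)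
    also have "\<dots> = ent (comp_arrow (mult \<B>) (tens_arrow D F F)) y x"
      using x y l by (subst ent_comp_arrow) (simp add: sF \<B>_def)
    finally show "ent (comp_arrow F (mult \<A>)) y x = ent (comp_arrow (mult \<B>) (tens_arrow D F F)) y x" .
  qed
  then have homF: "alg_hom (cat_of D) \<A> \<B> F"
    by (simp add: alg_hom_def F_def \<B>_def)
  show ?thesis
  proof (rule that[OF algB homF]; intro allI impI)
    fix v b assume v: "\<forall>y. (\<Sum>x\<in>?A. N y x * v x) = 0"
    show "(\<Sum>x\<in>?A. ent F b x * v x) = 0"
    proof (cases "b \<in> B")
      case True
      then show ?thesis
        using ind3[of v "\<lambda>_. 0" b] v by (simp add: entF)
    next
      case False
      then show ?thesis by (simp add: entF f_def)
    qed
  next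
    \<comment> \<open>The columns of \<open>N\<close> are combinations of those in \<open>B\<close>
      with coefficients from \<open>f\<close>, so \<open>f = 0\<close> forces
      \<open>N = 0\<close>.\<close>
    assume "F = Zero (cat_of D) ?A (car \<B>)"
    then have "f b x = 0" for b x
      using entF[of b x] by simp
    then have "N y x = 0" for y x
      using f[of x y] N[of y x] by (cases "x \<in> ?A") auto
    then show "N = (\<lambda>y x. 0)" by blast
  qed
qed

end

section \<open>Connectedness of simple commutative algebras\<close>

text \<open>A bijection transports the matrix from \<open>S\<close> to the indices
  \<open>{0..<n}\<close>. Its characteristic polynomial has degree \<open>card S\<close>, positive
  because \<open>S\<close> is non-empty, and so has a root.\<close>

lemma exists_eigenvector:
  fixes M :: "'a \<Rightarrow> 'a \<Rightarrow> 'k::alg_closed_field"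
  assumes fin: "finite S" and ne: "S \<noteq> {}"
  obtains c v where "\<exists>x\<in>S. v x \<noteq> 0" "\<And>y. y \<in> S \<Longrightarrow> (\<Sum>x\<in>S. M y x * v x) = c * v y"
proof -
  define n where "n = card S"
  obtain h where h: "bij_betw h {0..<n} S"
    using ex_bij_betw_nat_finite[OF fin] n_def by blast
  define B where "B = mat n n (\<lambda>(i, j). M (h i) (h j))"
  have B: "B \<in> carrier_mat n n" by (simp add: B_def)
  have "degree (char_poly B) \<noteq> 0"
    using degree_monic_char_poly[OF B] ne fin by (simp add: n_def)
  then obtain c where "poly (char_poly B) c = 0"
    using alg_closed_imp_poly_has_root[of "char_poly B"] by auto
  then have "eigenvalue B c"
    using eigenvalue_root_char_poly[OF B] by simp
  then obtain w where w: "w \<in> carrier_vec n" "w \<noteq> 0\<^sub>v n" "B *\<^sub>v w = c \<cdot>\<^sub>v w"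
    using B unfolding eigenvalue_def eigenvector_def by auto
  define g where "g = the_inv_into {0..<n} h"
  have gh: "g (h i) = i" if "i < n" for i
    using h that unfolding g_def bij_betw_def by (simp add: the_inv_into_f_f)
  define v where "v x = w $ g x" for x
  show ?thesis
  proof (rule that)
    obtain i where i: "i < n" "w $ i \<noteq> 0"
      using w(1,2) by (metis carrier_vecD eq_vecI index_zero_vec)
    then show "\<exists>x\<in>S. v x \<noteq> 0"
      using gh h unfolding v_def bij_betw_def by (intro bexI[of _ "h i"]) auto
  next
    fix y assume "y \<in> S"
    then obtain i where i: "i < n" "y = h i"
      using h unfolding bij_betw_def by auto
    have "(\<Sum>x\<in>S. M y x * v x) = (\<Sum>j\<in>{0..<n}. M y (h j) * v (h j))"
      by (rule sum.reindex_bij_betw[OF h, symmetric])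
    also have "\<dots> = (B *\<^sub>v w) $ i"
      using i w(1) by (simp add: B_def scalar_prod_def v_def gh)
    also have "\<dots> = c * v y"
      using i w(1) by (simp add: w(3) v_def gh)
    finally show "(\<Sum>x\<in>S. M y x * v x) = c * v y" .
  qed
qed

section \<open>Multiplication by elements of Hom(I, A)\<close>

context unital_fusion_data
begin

text \<open>The column of the braiding at \<open>Node (lab y) i j\<close> has at most one non-zero
  entry, at the swapped path, so commutativity becomes a scalar relation. When fusion excludes
  \<open>lab y\<close>, both constants vanish.\<close>

lemma commutative_sconst:
  assumes alg: "is_algebra (cat_of D) \<A>" and comm: "commutative_alg (cat_of D) \<A>"
    and ij: "i \<in> car \<A>" "j \<in> car \<A>"
  shows "sconst \<A> y i j = Rsym D (lab i) (lab j) (lab y) * sconst \<A> y j i"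
proof (cases "y \<in> car \<A> \<and> lab y \<in> fus D (lab i) (lab j)")
  case False
  then have "sconst \<A> y i j = 0" "sconst \<A> y j i = 0"
    using algebraD(8)[OF alg, of y i j] algebraD(8)[OF alg, of y j i] fus_commute by blast+
  then show ?thesis by simp
next
  case True
  note A = algebraD[OF alg]
  let ?T = "tens_obj D (car \<A>) (car \<A>)"
  have s: "src (mult \<A>) = ?T" "tgt (mult \<A>) = car \<A>"
    using hom_setD(1,2)[OF A(3)] .
  have m: "comp_arrow (mult \<A>) (mk_arrow ?T ?T (braid_ent D)) = mult \<A>"
    using comm by (simp add: commutative_alg_def)
  let ?x = "Node (lab y) i j"
  have x: "?x \<in> ?T" "Node (lab y) j i \<in> ?T"
    using True ij fus_commute by auto
  have "sconst \<A> y i j = (\<Sum>w\<in>?T. ent (mult \<A>) y w * ent (mk_arrow ?T ?T (braid_ent D)) w ?x)"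
    using x True unfolding sconst_def by (subst m[symmetric]) (simp add: ent_comp_arrow s)
  also have "\<dots> = (\<Sum>w\<in>{Node (lab y) j i}. ent (mult \<A>) y w * ent (mk_arrow ?T ?T (braid_ent D)) w ?x)"
  proof (rule sum.mono_neutral_right)
    show "\<forall>w\<in>?T - {Node (lab y) j i}. ent (mult \<A>) y w * ent (mk_arrow ?T ?T (braid_ent D)) w ?x = 0"
      by (auto elim!: tens_objE split: if_splits)
  qed (use A(1) x finite_tens_obj in auto)
  also have "\<dots> = Rsym D (lab i) (lab j) (lab y) * sconst \<A> y j i"
    using x by (simp add: sconst_def)
  finally show ?thesis .
qed

text \<open>The matrix of left multiplication by the element with coordinates \<open>s\<close>. For
  \<open>s\<close> supported on summands labelled \<open>one D\<close> it is an endomorphism of the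
  object \<open>A\<close>.\<close>

definition act :: "('l sobj, ('l, 'k) arrow) alg \<Rightarrow> ('l summand \<Rightarrow> 'k) \<Rightarrow> 'l summand \<Rightarrow> 'l summand \<Rightarrow> 'k" where
  "act \<A> s y x = (\<Sum>q\<in>car \<A>. s q * sconst \<A> y q x)"

lemma act_nonzero:
  assumes alg: "is_algebra (cat_of D) \<A>" and s: "\<forall>q. s q \<noteq> 0 \<longrightarrow> lab q = one D"
    and nz: "act \<A> s y x \<noteq> 0"
  shows "y \<in> car \<A> \<and> x \<in> car \<A> \<and> lab y = lab x"
proof -
  obtain q where "s q * sconst \<A> y q x \<noteq> 0"
    using nz unfolding act_def by (rule sum.not_neutral_contains_not_neutral)
  then have "s q \<noteq> 0" "sconst \<A> y q x \<noteq> 0" by auto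
  then show ?thesis
    using s algebraD(8)[OF alg, of y q x] fus_one(1) algebraD(2)[OF alg, of x] by auto
qed

text \<open>Associativity for s, x, j, that is (sx)j = s(xj). The first factor has the trivial
  label, so the only channel is \<open>lab x\<close> and the symbol \<open>Fsym\<close> is
  1.\<close>

lemma act_left:
  assumes alg: "is_algebra (cat_of D) \<A>" and s: "\<forall>q. s q \<noteq> 0 \<longrightarrow> lab q = one D"
    and as: "y \<in> car \<A>" "x \<in> car \<A>" "j \<in> car \<A>"
  shows "(\<Sum>x'\<in>car \<A>. sconst \<A> y x' j * act \<A> s x' x) = (\<Sum>y'\<in>car \<A>. act \<A> s y y' * sconst \<A> y' x j)"
proof -
  note A = algebraD[OF alg]
  let ?A = "car \<A>" and ?m = "sconst \<A>"
  have fus: "fus D (one D) (lab x) = {lab x}"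
    using A(2) as fus_one by auto
  have "(\<Sum>x'\<in>?A. ?m y x' j * act \<A> s x' x) = (\<Sum>q\<in>?A. s q * (\<Sum>x'\<in>?A. ?m y x' j * ?m x' q x))"
    unfolding act_def sum_distrib_left by (subst sum.swap) (simp add: mult_ac)
  also have "\<dots> = (\<Sum>q\<in>?A. s q * (\<Sum>y'\<in>?A. ?m y q y' * ?m y' x j))"
  proof (rule sum.cong[OF refl])
    fix q assume q: "q \<in> ?A"
    show "s q * (\<Sum>x'\<in>?A. ?m y x' j * ?m x' q x) = s q * (\<Sum>y'\<in>?A. ?m y q y' * ?m y' x j)"
    proof (cases "s q = 0")
      case False
      then have l: "lab q = one D" using s by blast
      have lx: "lab x' = lab x" if "?m x' q x \<noteq> 0" for x'
        using A(8)[OF that] unfolding l fus by simp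
      have ly: "lab y = lab y'" if "?m y q y' \<noteq> 0" for y'
        using A(8)[OF that] fus_one(1)[OF A(2)[of y']] unfolding l by simp
      have "(\<Sum>x'\<in>?A. ?m y x' j * ?m x' q x) = (\<Sum>y'\<in>?A. ?m y q y' * ?m y' x j)"
      proof (cases "lab y \<in> fus D (lab x) (lab j)")
        case True
        have "(\<Sum>x'\<in>?A. ?m y x' j * ?m x' q x) = (\<Sum>x' | x' \<in> ?A \<and> lab x' = lab x. ?m y x' j * ?m x' q x)"
        proof (rule sum.mono_neutral_right)
          show "\<forall>x'\<in>?A - {x' \<in> ?A. lab x' = lab x}. ?m y x' j * ?m x' q x = 0"
            using lx by (metis (mono_tags, lifting) DiffE mem_Collect_eq mult_zero_right)
        qed (use A(1) in auto)
        then show ?thesis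
          using A(5)[of q x j y "lab x"] q as True l fus Fsym_one by simp
      next
        case False
        \<comment> \<open>When fusion forbids \<open>lab y\<close>, associativity supplies no
          equation, but every term on either side is 0.\<close>
        have "?m y x' j * ?m x' q x = 0" for x'
        proof (rule ccontr)
          assume "?m y x' j * ?m x' q x \<noteq> 0"
          then have "?m y x' j \<noteq> 0" "?m x' q x \<noteq> 0" by auto
          with A(8)[of y x' j] lx[of x'] False show False by simp
        qed
        moreover have "?m y q y' * ?m y' x j = 0" for y'
        proof (rule ccontr)
          assume "?m y q y' * ?m y' x j \<noteq> 0"
          then have "?m y q y' \<noteq> 0" "?m y' x j \<noteq> 0" by auto
          with A(8)[of y' x j] ly[of y'] False show False by simp
        qed
        ultimately show ?thesis
          by (simp only: sum.neutral_const)
      qed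
      then show ?thesis by simp
    qed simp
  qed
  also have "\<dots> = (\<Sum>y'\<in>?A. act \<A> s y y' * ?m y' x j)"
    unfolding act_def sum_distrib_left sum_distrib_right by (subst sum.swap) (simp add: mult_ac)
  finally show ?thesis .
qed

text \<open>Swapping both products costs a scalar that depends only on labels. Multiplication by
  \<open>s\<close> preserves labels, so the scalar is the same on both sides and
  \<open>act_left\<close> carries over.\<close>

lemma act_right:
  assumes alg: "is_algebra (cat_of D) \<A>" and comm: "commutative_alg (cat_of D) \<A>"
    and s: "\<forall>q. s q \<noteq> 0 \<longrightarrow> lab q = one D"
    and as: "y \<in> car \<A>" "x \<in> car \<A>" "j \<in> car \<A>"
  shows "(\<Sum>x'\<in>car \<A>. sconst \<A> y j x' * act \<A> s x' x) = (\<Sum>y'\<in>car \<A>. act \<A> s y y' * sconst \<A> y' j x)"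
proof -
  let ?A = "car \<A>" and ?m = "sconst \<A>" and ?R = "Rsym D (lab j) (lab x) (lab y)"
  note nz = act_nonzero[OF alg s]
  have "?m y j x' * act \<A> s x' x = ?R * (?m y x' j * act \<A> s x' x)" if "x' \<in> ?A" for x'
    using nz[of x' x] that as commutative_sconst[OF alg comm, of j x' y]
    by (cases "act \<A> s x' x = 0") auto
  then have "(\<Sum>x'\<in>?A. ?m y j x' * act \<A> s x' x) = ?R * (\<Sum>x'\<in>?A. ?m y x' j * act \<A> s x' x)"
    unfolding sum_distrib_left by (rule sum.cong[OF refl])
  also have "\<dots> = ?R * (\<Sum>y'\<in>?A. act \<A> s y y' * ?m y' x j)"
    using act_left[OF alg s as] by simp
  also have "\<dots> = (\<Sum>y'\<in>?A. act \<A> s y y' * ?m y' j x)"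
    unfolding sum_distrib_left
  proof (rule sum.cong[OF refl])
    fix y' assume "y' \<in> ?A"
    show "?R * (act \<A> s y y' * ?m y' x j) = act \<A> s y y' * ?m y' j x"
      using nz[of y y'] as commutative_sconst[OF alg comm, of j x y']
      by (cases "act \<A> s y y' = 0") auto
  qed
  finally show ?thesis .
qed

text \<open>The equation s1 = s recovers \<open>s\<close> from its matrix: once \<open>act\<close>
  vanishes, so does \<open>s\<close> on the carrier.\<close>

lemma act_unit:
  assumes alg: "is_algebra (cat_of D) \<A>" and y: "y \<in> car \<A>"
  shows "(\<Sum>x\<in>car \<A>. act \<A> s y x * ucoef D \<A> x) = s y"
proof -
  note A = algebraD[OF alg]
  have "(\<Sum>x\<in>car \<A>. act \<A> s y x * ucoef D \<A> x) =
      (\<Sum>q\<in>car \<A>. s q * (\<Sum>x\<in>car \<A>. sconst \<A> y q x * ucoef D \<A> x))"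
    unfolding act_def sum_distrib_left sum_distrib_right by (subst sum.swap) (simp add: mult_ac)
  also have "\<dots> = (\<Sum>q\<in>car \<A>. if q = y then s q else 0)"
    by (intro sum.cong refl) (use A(7) y in auto)
  finally show ?thesis
    using A(1) y by simp
qed

text \<open>\<open>act_left\<close> and \<open>act_right\<close> make the kernel of multiplication
  by \<open>s\<close> an ideal. The map to the quotient is non-zero because \<open>s\<close> does
  not act as zero, hence mono by simplicity. It kills \<open>v\<close>, and comparing the arrows
  \<open>v\<close> and 0 from the unit object gives v = 0.\<close>

lemma simple_act_injective:
  assumes alg: "is_algebra (cat_of D) \<A>" and simple: "simple_alg (cat_of D) \<A>"
    and comm: "commutative_alg (cat_of D) \<A>"
    and s: "\<forall>q. s q \<noteq> 0 \<longrightarrow> lab q = one D"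
    and nz: "act \<A> s \<noteq> (\<lambda>y x. 0)"
    and v: "\<And>x. v x \<noteq> 0 \<Longrightarrow> x \<in> car \<A> \<and> lab x = one D"
    and ker: "\<And>y. (\<Sum>x\<in>car \<A>. act \<A> s y x * v x) = 0"
  shows "v x = 0"
proof -
  let ?U = "unit_summand D"
  obtain \<B> f where algB: "is_algebra (cat_of D) \<B>" and hom: "alg_hom (cat_of D) \<A> \<B> f"
    and fker: "\<forall>v. (\<forall>y. (\<Sum>x\<in>car \<A>. act \<A> s y x * v x) = 0) \<longrightarrow> (\<forall>b. (\<Sum>x\<in>car \<A>. ent f b x * v x) = 0)"
    and fnz: "f = Zero (cat_of D) (car \<A>) (car \<B>) \<longrightarrow> act \<A> s = (\<lambda>y x. 0)"
    by (rule quotient_algebra[where N = "act \<A> s", OF alg act_nonzero[OF alg s] act_left[OF alg s]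
          act_right[OF alg comm s]])
      (assumption | rule that; assumption)+
  have "f \<noteq> Zero (cat_of D) (car \<A>) (car \<B>)"
    using fnz nz by blast
  then have mono: "mono_arrow (cat_of D) (car \<A>) (car \<B>) f"
    using simple algB hom unfolding simple_alg_def by blast
  have f: "f \<in> hom_set (car \<A>) (car \<B>)"
    using hom by (simp add: alg_hom_def)
  note sf = hom_setD(1,2)[OF f]
  let ?g = "mk_arrow {?U} (car \<A>) (\<lambda>y x. v y)" and ?z = "mk_arrow {?U} (car \<A>) (\<lambda>y x. 0 :: 'k)"
  have "comp_arrow f ?g = comp_arrow f ?z"
  proof (rule hom_set_eqI[of _ "{?U}" "car \<B>"])
    show "comp_arrow f ?g \<in> hom_set {?U} (car \<B>)" "comp_arrow f ?z \<in> hom_set {?U} (car \<B>)"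
      using comp_arrow_in_hom_set[of f ?g] comp_arrow_in_hom_set[of f ?z] by (simp_all add: sf)
    fix x y assume xy: "x \<in> {?U}" "y \<in> car \<B>" "lab y = lab x"
    have "ent (comp_arrow f ?g) y x = (\<Sum>q\<in>car \<A>. ent f y q * v q)"
      using xy v by (auto simp: ent_comp_arrow sf intro!: sum.cong)
    also have "\<dots> = 0"
      using fker ker by blast
    also have "\<dots> = ent (comp_arrow f ?z) y x"
      by (simp add: ent_comp_arrow sum.neutral)
    finally show "ent (comp_arrow f ?g) y x = ent (comp_arrow f ?z) y x" .
  qed
  moreover have "{?U} \<in> Obj (cat_of D)"
    by (simp add: one_simple)
  moreover have "\<forall>g\<in>hom_set {?U} (car \<A>). \<forall>h\<in>hom_set {?U} (car \<A>). comp_arrow f g = comp_arrow f h \<longrightarrow> g = h"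
    if "{?U} \<in> Obj (cat_of D)"
    using mono that unfolding mono_arrow_def cat_of_simps(2,4) by blast
  ultimately have "?g = ?z"
    by simp
  then have "ent ?g x ?U = ent ?z x ?U" by simp
  then show ?thesis
    using v[of x] by (auto split: if_splits)
qed

end

lemma simple_commutative_connected:
  fixes D :: "('l, 'k::alg_closed_field) fusion_data"
  assumes "unital_fusion_data D"
    and alg: "is_algebra (cat_of D) \<A>" and simple: "simple_alg (cat_of D) \<A>"
    and comm: "commutative_alg (cat_of D) \<A>"
  obtains q where "{p \<in> car \<A>. lab p = one D} = {q}"
proof -
  interpret unital_fusion_data D by fact
  note A = algebraD[OF alg]
  let ?S = "{p \<in> car \<A>. lab p = one D}" and ?\<iota> = "ucoef D \<A>"
  \<comment> \<open>Without a unit summand the unit law would read 0 = 1 at any summand of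
    \<open>A\<close>, and a simple algebra is not zero.\<close>
  have ne: "?S \<noteq> {}"
  proof
    assume empty: "?S = {}"
    have "car \<A> \<noteq> {}"
      using simple unfolding simple_alg_def by (force simp: mk_arrow_def)
    then obtain x where x: "x \<in> car \<A>" by auto
    have "?\<iota> q = 0" for q
      using A(9)[of q] empty by blast
    then show False
      using A(6)[OF x x] by simp
  qed
  have scalar: "\<exists>c. \<forall>q\<in>car \<A>. t q = c * ?\<iota> q" if t: "\<And>q. t q \<noteq> 0 \<Longrightarrow> lab q = one D" for t
  proof -
    obtain c v0 where v0: "\<exists>x\<in>?S. v0 x \<noteq> 0"
      and ev: "\<And>y. y \<in> ?S \<Longrightarrow> (\<Sum>x\<in>?S. act \<A> t y x * v0 x) = c * v0 y"
      by (rule exists_eigenvector[of ?S "act \<A> t"]) (use A(1) ne in auto)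
    define v where "v x = (if x \<in> ?S then v0 x else 0)" for x
    \<comment> \<open>This is t - c1 for the eigenvalue c. It annihilates the eigenvector, extended
      by 0 to an element \<open>v\<close> of Hom(I, A).\<close>
    define s where "s q = t q - c * ?\<iota> q" for q
    have s: "\<forall>q. s q \<noteq> 0 \<longrightarrow> lab q = one D"
      using t A(9) by (metis diff_self mult_zero_right s_def)
    have as: "act \<A> s y x = act \<A> t y x - c * of_bool (x = y)" if "x \<in> car \<A>" "y \<in> car \<A>" for x y
    proof -
      have "act \<A> s y x = act \<A> t y x - c * (\<Sum>q\<in>car \<A>. sconst \<A> y q x * ?\<iota> q)"
        by (simp add: act_def s_def algebra_simps sum_subtractf sum_distrib_left)
      then show ?thesis using A(6)[OF that] by simp
    qed
    have "act \<A> s = (\<lambda>y x. 0)"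
    proof (rule ccontr)
      assume nz: "act \<A> s \<noteq> (\<lambda>y x. 0)"
      have "v x = 0" for x
      proof (rule simple_act_injective[OF alg simple comm s nz])
        show "\<And>x. v x \<noteq> 0 \<Longrightarrow> x \<in> car \<A> \<and> lab x = one D"
          by (auto simp: v_def split: if_splits)
        fix y
        show "(\<Sum>x\<in>car \<A>. act \<A> s y x * v x) = 0"
        proof (cases "y \<in> ?S")
          case True
          have "(\<Sum>x\<in>car \<A>. act \<A> s y x * v x) = (\<Sum>x\<in>?S. act \<A> s y x * v0 x)"
            by (rule sum.mono_neutral_cong_right) (use A(1) in \<open>auto simp: v_def\<close>)
          also have "\<dots> = (\<Sum>x\<in>?S. act \<A> t y x * v0 x - (if x = y then c * v0 x else 0))"
            by (intro sum.cong refl) (use True in \<open>auto simp: as left_diff_distrib\<close>)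
          also have "\<dots> = c * v0 y - c * v0 y"
            using ev[OF True] True A(1) by (simp add: sum_subtractf)
          finally show ?thesis by simp
        next
          case False
          have "act \<A> s y x * v x = 0" for x
            using act_nonzero[OF alg s, of y x] False by (cases "act \<A> s y x = 0") (auto simp: v_def)
          then show ?thesis by (intro sum.neutral) blast
        qed
      qed
      then have "v0 x = 0" if "x \<in> ?S" for x
        using that unfolding v_def by presburger
      with v0 show False by blast
    qed
    then have "s q = 0" if "q \<in> car \<A>" for q
      using act_unit[OF alg that, of s] by simp
    then have "\<forall>q\<in>car \<A>. t q = c * ?\<iota> q"
      by (simp add: s_def)
    then show ?thesis ..
  qed
  have "p = q" if p: "p \<in> ?S" and q: "q \<in> ?S" for p q
  proof (rule ccontr)
    assume pq: "p \<noteq> q"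
    \<comment> \<open>The indicators of two unit summands would both be multiples of the unit
      coefficients, although they are independent.\<close>
    obtain c where c: "\<And>r. r \<in> car \<A> \<Longrightarrow> of_bool (r = p) = c * ?\<iota> r"
      using scalar[of "\<lambda>r. of_bool (r = p)"] p by auto
    obtain d where d: "\<And>r. r \<in> car \<A> \<Longrightarrow> of_bool (r = q) = d * ?\<iota> r"
      using scalar[of "\<lambda>r. of_bool (r = q)"] q by auto
    show False
      using c[of p] c[of q] d[of q] p q pq by auto
  qed
  note unique = this
  obtain q where q: "q \<in> ?S"
    using ne by blast
  have "?S = {q}"
  proof (intro equalityI subsetI)
    show "p \<in> {q}" if "p \<in> ?S" for p
      using unique[OF that q] by simp
  qed (use q in simp)
  then show ?thesis by (rule that)
qed

section \<open>The trace pairing\<close>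

lemma ent_comp_arrow_nonzeroE:
  assumes "ent (comp_arrow g f) z x \<noteq> 0"
  obtains y where "y \<in> tgt f" "ent g z y \<noteq> 0" "ent f y x \<noteq> 0"
proof -
  have "(\<Sum>y\<in>tgt f. ent g z y * ent f y x) \<noteq> 0"
    using assms by (simp add: ent_comp_arrow split: if_splits)
  then obtain y where "y \<in> tgt f" "ent g z y * ent f y x \<noteq> 0"
    by (rule sum.not_neutral_contains_not_neutral)
  then show ?thesis by (intro that[of y]) auto
qed

lemma ent_tens_arrow_nonzeroE:
  assumes "ent (tens_arrow D f g) y x \<noteq> 0"
  obtains c i j i' j' where "x = Node c i j" "y = Node c i' j'" "ent f i' i \<noteq> 0" "ent g j' j \<noteq> 0"
proof -
  have x: "x \<in> tens_obj D (src f) (src g)" and y: "y \<in> tens_obj D (tgt f) (tgt g)"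
    and l: "lab y = lab x" and nz: "tens_ent f g y x \<noteq> 0"
    using assms by (auto simp: ent_tens_arrow split: if_splits)
  obtain c i j c' i' j' where "x = Node c i j" "y = Node c' i' j'"
    using x y by (auto simp: tens_obj_def)
  then show ?thesis
    using l nz by (intro that[of c i j i' j']) auto
qed

text \<open>The trace is a morphism to the unit object, so it vanishes on summands with any other
  label. This forces the non-zero component found in \<open>separable_pairing\<close> to lie in a
  unit summand.\<close>

lemma ent_alg_trace_nonzero:
  assumes "ent (alg_trace (cat_of D) \<A>) z x \<noteq> 0"
  shows "z = unit_summand D \<and> lab x = one D"
  using assms by (auto simp: alg_trace_def Let_def ent_comp_arrow[of "mk_arrow _ _ _"] split: if_splits)

section \<open>Inverse associators and unitors\<close>

fun assoc_inv_ent :: "('l, 'k) fusion_data \<Rightarrow> 'l summand \<Rightarrow> 'l summand \<Rightarrow> 'k::zero" where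
  "assoc_inv_ent D (Node d (Node e i j) k) (Node d' i' (Node f j' k')) =
     (if i' = i \<and> j' = j \<and> k' = k then Fsym D (lab i) (lab j) (lab k) d f e else 0)"
| "assoc_inv_ent D _ _ = 0"

text \<open>The F-matrices of the Fibonacci category are involutions, which gives the inverse associator.\<close>

locale involutive_fusion_data = unital_fusion_data +
  assumes Fsym_involutive:
    "\<And>a b c d e e'. a \<in> simples D \<Longrightarrow> b \<in> simples D \<Longrightarrow> c \<in> simples D \<Longrightarrow>
       e \<in> fus D a b \<Longrightarrow> d \<in> fus D e c \<Longrightarrow> e' \<in> fus D a b \<Longrightarrow> d \<in> fus D e' c \<Longrightarrow>
       (\<Sum>f | f \<in> fus D b c \<and> d \<in> fus D a f. Fsym D a b c d f e' * Fsym D a b c d e f) = of_bool (e' = e)"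
    "\<And>a b c d f f'. a \<in> simples D \<Longrightarrow> b \<in> simples D \<Longrightarrow> c \<in> simples D \<Longrightarrow>
       f \<in> fus D b c \<Longrightarrow> d \<in> fus D a f \<Longrightarrow> f' \<in> fus D b c \<Longrightarrow> d \<in> fus D a f' \<Longrightarrow>
       (\<Sum>e | e \<in> fus D a b \<and> d \<in> fus D e c. Fsym D a b c d e f' * Fsym D a b c d f e) = of_bool (f' = f)"
begin

text \<open>The associator fixes the three leaves and the total label, so each composite reduces to
  a sum over one intermediate label, which is an entry of the square of an F-matrix.\<close>

lemma inverse_Assoc:
  assumes A: "A \<in> Obj (cat_of D)"
  shows "inverse_arrow (cat_of D) (tens_obj D (tens_obj D A A) A) (tens_obj D A (tens_obj D A A))
      (Assoc (cat_of D) A A A) =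
    mk_arrow (tens_obj D A (tens_obj D A A)) (tens_obj D (tens_obj D A A) A) (assoc_inv_ent D)"
    (is "inverse_arrow _ ?L ?R ?\<alpha> = ?\<beta>")
proof (rule inverse_arrow_eqI)
  have fin: "finite A" and lab: "\<And>i. i \<in> A \<Longrightarrow> lab i \<in> simples D"
    using A by auto
  show finL: "finite ?L" and finR: "finite ?R"
    using fin by (auto intro!: finite_tens_obj)
  show "?\<alpha> \<in> hom_set ?L ?R" "?\<beta> \<in> hom_set ?R ?L"
    by simp_all
  show "comp_arrow ?\<beta> ?\<alpha> = id_arrow ?L"
  proof (rule hom_set_eqI)
    show "comp_arrow ?\<beta> ?\<alpha> \<in> hom_set ?L ?L"
      using comp_arrow_in_hom_set[of ?\<beta> ?\<alpha>] by simp
    fix x y assume x: "x \<in> ?L" and y: "y \<in> ?L" and l: "lab y = lab x"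
    obtain d e i j k where xx: "x = Node d (Node e i j) k" "i \<in> A" "j \<in> A" "k \<in> A"
        "e \<in> fus D (lab i) (lab j)" "d \<in> fus D e (lab k)"
      using x by (auto elim!: tens_objE)
    obtain e' i' j' k' where yy: "y = Node d (Node e' i' j') k'" "i' \<in> A" "j' \<in> A" "k' \<in> A"
        "e' \<in> fus D (lab i') (lab j')" "d \<in> fus D e' (lab k')"
      using y l xx(1) by (auto elim!: tens_objE)
    let ?h = "\<lambda>f. Node d i (Node f j k)"
    let ?F = "Fsym D (lab i) (lab j) (lab k) d"
    have "ent (comp_arrow ?\<beta> ?\<alpha>) y x = (\<Sum>w\<in>?R. ent ?\<beta> y w * ent ?\<alpha> w x)"
      using x y l by (subst ent_comp_arrow) simp
    also have "\<dots> = (\<Sum>f | f \<in> fus D (lab j) (lab k) \<and> d \<in> fus D (lab i) f. ent ?\<beta> y (?h f) * ent ?\<alpha> (?h f) x)"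
    proof (rule sum_eq_sum_image)
      fix w assume w: "w \<in> ?R" "ent ?\<beta> y w * ent ?\<alpha> w x \<noteq> 0"
      obtain d' i'' f j'' k'' where ww: "w = Node d' i'' (Node f j'' k'')"
          "f \<in> fus D (lab j'') (lab k'')" "d' \<in> fus D (lab i'') f"
        using w(1) by (auto elim!: tens_objE)
      have "ent ?\<alpha> w x \<noteq> 0" using w(2) by auto
      then have "d' = d" "i'' = i" "j'' = j" "k'' = k"
        unfolding ww xx(1) by (auto split: if_splits)
      then show "w \<in> ?h ` {f. f \<in> fus D (lab j) (lab k) \<and> d \<in> fus D (lab i) f}"
        using ww by auto
    next
      show "finite {f. f \<in> fus D (lab j) (lab k) \<and> d \<in> fus D (lab i) f}"
        using finite_fus by simp
    qed (use finR in \<open>auto simp: inj_on_def\<close>)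
    also have "\<dots> = (\<Sum>f | f \<in> fus D (lab j) (lab k) \<and> d \<in> fus D (lab i) f.
        if i' = i \<and> j' = j \<and> k' = k then ?F f e' * ?F e f else 0)"
      unfolding xx(1) yy(1) using xx yy by (intro sum.cong refl) auto
    also have "\<dots> = of_bool (y = x)"
    proof (cases "i' = i \<and> j' = j \<and> k' = k")
      case True
      then show ?thesis
        using Fsym_involutive(1)[OF lab[OF xx(2)] lab[OF xx(3)] lab[OF xx(4)] xx(5,6), of e'] yy(5,6)
        by (simp add: xx(1) yy(1))
    next
      case False
      then show ?thesis
        by (auto simp: xx(1) yy(1) intro!: sum.neutral)
    qed
    also have "\<dots> = ent (id_arrow ?L) y x"
      using x y l by simp
    finally show "ent (comp_arrow ?\<beta> ?\<alpha>) y x = ent (id_arrow ?L) y x" .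
  qed simp
  show "comp_arrow ?\<alpha> ?\<beta> = id_arrow ?R"
  proof (rule hom_set_eqI)
    show "comp_arrow ?\<alpha> ?\<beta> \<in> hom_set ?R ?R"
      using comp_arrow_in_hom_set[of ?\<alpha> ?\<beta>] by simp
    fix x y assume x: "x \<in> ?R" and y: "y \<in> ?R" and l: "lab y = lab x"
    obtain d f i j k where xx: "x = Node d i (Node f j k)" "i \<in> A" "j \<in> A" "k \<in> A"
        "f \<in> fus D (lab j) (lab k)" "d \<in> fus D (lab i) f"
      using x by (auto elim!: tens_objE)
    obtain f' i' j' k' where yy: "y = Node d i' (Node f' j' k')" "i' \<in> A" "j' \<in> A" "k' \<in> A"
        "f' \<in> fus D (lab j') (lab k')" "d \<in> fus D (lab i') f'"
      using y l xx(1) by (auto elim!: tens_objE)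
    let ?h = "\<lambda>e. Node d (Node e i j) k"
    let ?F = "Fsym D (lab i) (lab j) (lab k) d"
    have "ent (comp_arrow ?\<alpha> ?\<beta>) y x = (\<Sum>w\<in>?L. ent ?\<alpha> y w * ent ?\<beta> w x)"
      using x y l by (subst ent_comp_arrow) simp
    also have "\<dots> = (\<Sum>e | e \<in> fus D (lab i) (lab j) \<and> d \<in> fus D e (lab k). ent ?\<alpha> y (?h e) * ent ?\<beta> (?h e) x)"
    proof (rule sum_eq_sum_image)
      fix w assume w: "w \<in> ?L" "ent ?\<alpha> y w * ent ?\<beta> w x \<noteq> 0"
      obtain d' i'' e j'' k'' where ww: "w = Node d' (Node e i'' j'') k''"
          "e \<in> fus D (lab i'') (lab j'')" "d' \<in> fus D e (lab k'')"
        using w(1) by (auto elim!: tens_objE)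
      have "ent ?\<beta> w x \<noteq> 0" using w(2) by auto
      then have "d' = d" "i'' = i" "j'' = j" "k'' = k"
        unfolding ww xx(1) by (auto split: if_splits)
      then show "w \<in> ?h ` {e. e \<in> fus D (lab i) (lab j) \<and> d \<in> fus D e (lab k)}"
        using ww by auto
    next
      show "finite {e. e \<in> fus D (lab i) (lab j) \<and> d \<in> fus D e (lab k)}"
        using finite_fus by simp
    qed (use finL in \<open>auto simp: inj_on_def\<close>)
    also have "\<dots> = (\<Sum>e | e \<in> fus D (lab i) (lab j) \<and> d \<in> fus D e (lab k).
        if i' = i \<and> j' = j \<and> k' = k then ?F e f' * ?F f e else 0)"
      unfolding xx(1) yy(1) using xx yy by (intro sum.cong refl) auto
    also have "\<dots> = of_bool (y = x)"
    proof (cases "i' = i \<and> j' = j \<and> k' = k")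
      case True
      then show ?thesis
        using Fsym_involutive(2)[OF lab[OF xx(2)] lab[OF xx(3)] lab[OF xx(4)] xx(5,6), of f'] yy(5,6)
        by (simp add: xx(1) yy(1))
    next
      case False
      then show ?thesis
        by (auto simp: xx(1) yy(1) intro!: sum.neutral)
    qed
    also have "\<dots> = ent (id_arrow ?R) y x"
      using x y l by simp
    finally show "ent (comp_arrow ?\<alpha> ?\<beta>) y x = ent (id_arrow ?R) y x" .
  qed simp
qed

lemma inverse_Runit:
  assumes A: "A \<in> Obj (cat_of D)"
  shows "inverse_arrow (cat_of D) (tens_obj D A {unit_summand D}) A (Runit (cat_of D) A) =
    mk_arrow A (tens_obj D A {unit_summand D}) (\<lambda>y x. of_bool (y = Node (lab x) x (unit_summand D)))"
    (is "inverse_arrow _ ?L A ?\<rho> = ?\<sigma>")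
proof (rule inverse_arrow_eqI)
  let ?h = "\<lambda>x. Node (lab x) x (unit_summand D)"
  show fin: "finite A"
    using A by auto
  have fus: "fus D (lab i) (one D) = {lab i}" if "i \<in> A" for i
    using A fus_one that by auto
  show finL: "finite ?L"
    using fin by (auto intro!: finite_tens_obj)
  show "?\<rho> \<in> hom_set ?L A" "?\<sigma> \<in> hom_set A ?L"
    by simp_all
  have hL: "\<exists>i\<in>A. x = ?h i" if "x \<in> ?L" for x
    using that fus by (auto elim!: tens_objE)
  have hin: "?h i \<in> ?L" if "i \<in> A" for i
    using that fus by auto
  show "comp_arrow ?\<sigma> ?\<rho> = id_arrow ?L"
  proof (rule hom_set_eqI)
    show "comp_arrow ?\<sigma> ?\<rho> \<in> hom_set ?L ?L"
      using comp_arrow_in_hom_set[of ?\<sigma> ?\<rho>] by simp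
    fix x y assume x: "x \<in> ?L" and y: "y \<in> ?L" and l: "lab y = lab x"
    obtain i where i: "i \<in> A" "x = ?h i" using hL[OF x] by blast
    have "ent (comp_arrow ?\<sigma> ?\<rho>) y x = (\<Sum>w\<in>A. ent ?\<sigma> y w * ent ?\<rho> w x)"
      using x y l by (subst ent_comp_arrow) simp
    also have "\<dots> = (\<Sum>w\<in>A. if w = i then of_bool (y = ?h i) else 0)"
      using i y hin by (intro sum.cong refl) auto
    also have "\<dots> = of_bool (y = x)"
      using i fin by simp
    finally show "ent (comp_arrow ?\<sigma> ?\<rho>) y x = ent (id_arrow ?L) y x"
      using x y l by simp
  qed simp
  show "comp_arrow ?\<rho> ?\<sigma> = id_arrow A"
  proof (rule hom_set_eqI)
    show "comp_arrow ?\<rho> ?\<sigma> \<in> hom_set A A"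
      using comp_arrow_in_hom_set[of ?\<rho> ?\<sigma>] by simp
    fix x y assume x: "x \<in> A" and y: "y \<in> A" and l: "lab y = lab x"
    have "ent (comp_arrow ?\<rho> ?\<sigma>) y x = (\<Sum>w\<in>?L. ent ?\<rho> y w * ent ?\<sigma> w x)"
      using x y l by (subst ent_comp_arrow) simp
    also have "\<dots> = (\<Sum>w\<in>?L. if w = ?h x then of_bool (y = x) else 0)"
      using x y l by (intro sum.cong refl) auto
    also have "\<dots> = of_bool (y = x)"
      using hin[OF x] finL by simp
    finally show "ent (comp_arrow ?\<rho> ?\<sigma>) y x = ent (id_arrow A) y x"
      using x y l by simp
  qed simp
qed

text \<open>The non-degeneracy identity has entry 1 at (i, i), so some chain of non-zero entries
  leads from \<open>i\<close> back to \<open>i\<close>. One link of this chain is the pairing of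
  \<open>i\<close> with a summand, and a non-zero pairing needs a product with a component in a unit
  summand.\<close>

lemma separable_pairing:
  assumes alg: "is_algebra (cat_of D) \<A>" and sep: "separable_alg (cat_of D) \<A>"
    and i: "i \<in> car \<A>"
  obtains y p where "y \<in> car \<A>" "p \<in> car \<A>" "lab y = one D" "sconst \<A> y i p \<noteq> 0"
proof -
  note A = algebraD[OF alg]
  let ?A = "car \<A>" and ?U = "unit_summand D"
  have obj: "?A \<in> Obj (cat_of D)"
    using A(1,2) by auto
  define P where "P = comp_arrow (alg_trace (cat_of D) \<A>) (mult \<A>)"
  let ?\<Phi> = "\<lambda>\<kappa>. comp_arrow (Lunit (cat_of D) ?A) (comp_arrow (tens_arrow D P (id_arrow ?A))
      (comp_arrow (mk_arrow (tens_obj D ?A (tens_obj D ?A ?A)) (tens_obj D (tens_obj D ?A ?A) ?A) (assoc_inv_ent D))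
      (comp_arrow (tens_arrow D (id_arrow ?A) \<kappa>)
        (mk_arrow ?A (tens_obj D ?A {?U}) (\<lambda>y x. of_bool (y = Node (lab x) x ?U))))))"
  obtain \<kappa> where eq: "?\<Phi> \<kappa> = id_arrow ?A"
    using sep unfolding separable_alg_def nondegenerate_def cat_of_simps(3-8) P_def[symmetric]
      inverse_Assoc[OF obj] inverse_Runit[OF obj] by blast
  have "ent (?\<Phi> \<kappa>) i i \<noteq> 0"
    by (subst eq) (use i in simp)
  then obtain y1 y2 y3 y4 where
      y12: "ent (tens_arrow D P (id_arrow ?A)) y1 y2 \<noteq> 0"
    and y23: "ent (mk_arrow (tens_obj D ?A (tens_obj D ?A ?A)) (tens_obj D (tens_obj D ?A ?A) ?A) (assoc_inv_ent D)) y2 y3 \<noteq> 0"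
    and y34: "ent (tens_arrow D (id_arrow ?A) \<kappa>) y3 y4 \<noteq> 0"
    and y4: "ent (mk_arrow ?A (tens_obj D ?A {?U}) (\<lambda>y x. of_bool (y = Node (lab x) x ?U)) :: ('a, 'b) arrow) y4 i \<noteq> 0"
    by (elim ent_comp_arrow_nonzeroE) blast
  \<comment> \<open>Followed from its source, the chain keeps \<open>i\<close> as leftmost leaf
    until the pairing \<open>P\<close> is applied to \<open>i\<close> and \<open>b\<close>.\<close>
  have "y4 = Node (lab i) i ?U"
    using y4 by (auto split: if_splits)
  then obtain c m where y3: "y3 = Node c i m"
    using y34 by (elim ent_tens_arrow_nonzeroE) (auto split: if_splits)
  obtain c' e b k where y2: "y2 = Node c' (Node e i b) k"
    using y23 unfolding y3 by (auto split: if_splits elim!: tens_objE)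
  obtain n where "ent P n (Node e i b) \<noteq> 0"
    using y12 unfolding y2 by (elim ent_tens_arrow_nonzeroE) auto
  then obtain y where y: "ent (alg_trace (cat_of D) \<A>) n y \<noteq> 0" "ent (mult \<A>) y (Node e i b) \<noteq> 0"
    unfolding P_def by (elim ent_comp_arrow_nonzeroE)
  have "y \<in> ?A" "lab y = e" "b \<in> ?A"
    using hom_setD(3)[OF A(3) y(2)] by auto
  moreover have "lab y = one D"
    using ent_alg_trace_nonzero[OF y(1)] by simp
  moreover have "sconst \<A> y i b \<noteq> 0"
    using y(2) \<open>lab y = e\<close> by (simp add: sconst_def)
  ultimately show ?thesis
    using that by blast
qed

end

section \<open>The F-matrices of the Fibonacci powers\<close>

lemma finite_lists_nth:
  assumes "\<And>n. finite (S n)"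
  shows "finite {z. length z = l \<and> (\<forall>n<l. z ! n \<in> S n)}"
proof (rule finite_subset)
  show "{z. length z = l \<and> (\<forall>n<l. z ! n \<in> S n)} \<subseteq> {z. set z \<subseteq> (\<Union>n<l. S n) \<and> length z = l}"
    by (force simp: in_set_conv_nth)
  show "finite {z. set z \<subseteq> (\<Union>n<l. S n) \<and> length z = l}"
    using assms by (intro finite_lists_length_eq) auto
qed

text \<open>Distributivity, by splitting off the last letter. It turns a sum over channels of a
  Deligne power into one sum for each factor.\<close>

lemma sum_lists_prod:
  fixes g :: "nat \<Rightarrow> 'a \<Rightarrow> 'k::comm_semiring_1"
  assumes fin: "\<And>n. finite (S n)"
  shows "(\<Sum>z | length z = l \<and> (\<forall>n<l. z ! n \<in> S n). \<Prod>n<l. g n (z ! n)) = (\<Prod>n<l. \<Sum>x\<in>S n. g n x)"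
proof (induction l)
  case 0
  have "{z :: 'a list. length z = 0 \<and> (\<forall>n<0. z ! n \<in> S n)} = {[]}" by auto
  then show ?case by simp
next
  case (Suc l)
  let ?L = "\<lambda>l. {z. length z = l \<and> (\<forall>n<l. z ! n \<in> S n)}"
  let ?h = "\<lambda>(z, x). z @ [x]"
  have "?L (Suc l) = ?h ` (?L l \<times> S l)"
  proof (intro equalityI subsetI)
    fix z assume z: "z \<in> ?L (Suc l)"
    then obtain w x where w: "z = w @ [x]" "length w = l"
      by (metis (mono_tags, lifting) length_Suc_conv_rev mem_Collect_eq)
    have "w ! n \<in> S n" if "n < l" for n
      using z that w by (force simp: nth_append dest: spec[of _ n])
    moreover have "x \<in> S l"
      using z w by (auto simp: nth_append dest: spec[of _ l])
    ultimately show "z \<in> ?h ` (?L l \<times> S l)"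
      using w by (intro image_eqI[of _ _ "(w, x)"]) auto
  next
    fix z assume "z \<in> ?h ` (?L l \<times> S l)"
    then show "z \<in> ?L (Suc l)"
      by (auto simp: nth_append less_Suc_eq)
  qed
  moreover have "inj_on ?h (?L l \<times> S l)"
    by (auto simp: inj_on_def)
  ultimately have "(\<Sum>z\<in>?L (Suc l). \<Prod>n<Suc l. g n (z ! n)) =
      (\<Sum>p\<in>?L l \<times> S l. \<Prod>n<Suc l. g n (?h p ! n))"
    by (simp add: sum.reindex)
  also have "\<dots> = (\<Sum>(z, x)\<in>?L l \<times> S l. (\<Prod>n<l. g n (z ! n)) * g l x)"
    by (intro sum.cong refl) (auto simp: nth_append intro!: arg_cong2[of _ _ _ _ "(*)"] prod.cong)
  also have "\<dots> = (\<Sum>z\<in>?L l. \<Prod>n<l. g n (z ! n)) * (\<Sum>x\<in>S l. g l x)"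
    by (simp add: sum_product sum.cartesian_product)
  finally show ?case
    by (simp add: Suc)
qed

lemma prod_of_bool:
  "finite S \<Longrightarrow> (\<Prod>n\<in>S. of_bool (P n)) = (of_bool (\<forall>n\<in>S. P n) :: 'k::comm_semiring_1)"
  by (induction S rule: finite_induct) auto

lemma fib_fus_commute: "fib_fus a b = fib_fus b a"
  by (cases a; cases b) auto

lemma fib_fus_right [simp]: "fib_fus a I = {a}"
  by (cases a) auto

lemma finite_fib_fus [simp]: "finite (fib_fus a b)"
  by (cases a; cases b) auto

lemma fib_F_one: "fib_F a I b c d e f = 1"
  by (cases b; cases c; cases d; cases e; cases f) auto

text \<open>Two channels occur only if \<open>a\<close>, \<open>b\<close>, \<open>c\<close>,
  \<open>d\<close> are all \<open>X\<close>. There, in the order \<open>X\<close>, \<open>I\<close>,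
  the matrix has rows (x, 1) and (-x, -x), and its square is x^2 - x = 1 times the identity. In
  every other admissible case there is one channel, with symbol 1.\<close>

lemma fib_F_involutive:
  fixes x :: "'k::field"
  assumes "x ^ 2 = x + 1"
  shows "e \<in> fib_fus a b \<Longrightarrow> d \<in> fib_fus e c \<Longrightarrow> e' \<in> fib_fus a b \<Longrightarrow> d \<in> fib_fus e' c \<Longrightarrow>
      (\<Sum>f | f \<in> fib_fus b c \<and> d \<in> fib_fus a f. fib_F x a b c d f e' * fib_F x a b c d e f) = of_bool (e' = e)"
    and "f \<in> fib_fus b c \<Longrightarrow> d \<in> fib_fus a f \<Longrightarrow> f' \<in> fib_fus b c \<Longrightarrow> d \<in> fib_fus a f' \<Longrightarrow>
      (\<Sum>e | e \<in> fib_fus a b \<and> d \<in> fib_fus e c. fib_F x a b c d e f' * fib_F x a b c d f e) = of_bool (f' = f)"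
proof -
  have x: "x * x = x + 1"
    using assms by (simp add: power2_eq_square)
  have 1: "(\<Sum>f | f \<in> fib_fus b c \<and> d \<in> fib_fus a f. G f) =
      (\<Sum>f\<in>fib_fus b c. if d \<in> fib_fus a f then G f else 0)" for G :: "fib \<Rightarrow> 'k"
    by (simp add: sum.inter_filter[symmetric])
  have 2: "(\<Sum>e | e \<in> fib_fus a b \<and> d \<in> fib_fus e c. G e) =
      (\<Sum>e\<in>fib_fus a b. if d \<in> fib_fus e c then G e else 0)" for G :: "fib \<Rightarrow> 'k"
    by (simp add: sum.inter_filter[symmetric])
  show "e \<in> fib_fus a b \<Longrightarrow> d \<in> fib_fus e c \<Longrightarrow> e' \<in> fib_fus a b \<Longrightarrow> d \<in> fib_fus e' c \<Longrightarrow>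
      (\<Sum>f | f \<in> fib_fus b c \<and> d \<in> fib_fus a f. fib_F x a b c d f e' * fib_F x a b c d e f) = of_bool (e' = e)"
    unfolding 1 by (cases a; cases b; cases c; cases d; cases e; cases e') (simp_all add: x)
  show "f \<in> fib_fus b c \<Longrightarrow> d \<in> fib_fus a f \<Longrightarrow> f' \<in> fib_fus b c \<Longrightarrow> d \<in> fib_fus a f' \<Longrightarrow>
      (\<Sum>e | e \<in> fib_fus a b \<and> d \<in> fib_fus e c. fib_F x a b c d e f' * fib_F x a b c d f e) = of_bool (f' = f)"
    unfolding 2 by (cases a; cases b; cases c; cases d; cases f; cases f') (simp_all add: x)
qed

section \<open>Fusion data of the Deligne powers\<close>

abbreviation fib_power_data :: "'k::field \<Rightarrow> nat \<Rightarrow> (fib list, 'k) fusion_data" where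
  "fib_power_data u l \<equiv> deligne_power (fib_data u) l"

lemma fib_power_data_simps [simp]:
  "simples (fib_power_data u l) = {w. length w = l}"
  "one (fib_power_data u l) = replicate l I"
  "fus (fib_power_data u l) v w = {z. length z = l \<and> (\<forall>n<l. z ! n \<in> fib_fus (v ! n) (w ! n))}"
  "Fsym (fib_power_data u l) a b c d e f =
     (\<Prod>n<l. fib_F (u + inverse u) (a ! n) (b ! n) (c ! n) (d ! n) (e ! n) (f ! n))"
  "twsym (fib_power_data u l) a = (\<Prod>n<l. case a ! n of I \<Rightarrow> 1 | X \<Rightarrow> inverse (u ^ 2))"
proof -
  have "a = I \<or> a = X" for a by (cases a) auto
  then have "set w \<subseteq> {I, X}" for w :: "fib list" by auto
  then show "simples (fib_power_data u l) = {w. length w = l}"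
    by (simp add: deligne_power_def fib_data_def)
qed (simp_all add: deligne_power_def fib_data_def)

text \<open>Fusion rules and symbols are factorwise, so each axiom reduces to a single Fibonacci
  factor; the sums over channels split by \<open>sum_lists_prod\<close>.\<close>

lemma fib_power_involutive:
  assumes u: "(u + inverse u) ^ 2 = u + inverse u + 1"
  shows "involutive_fusion_data (fib_power_data u l)"
proof
  fix a b :: "fib list"
  show "finite (fus (fib_power_data u l) a b)"
    using finite_lists_nth[of "\<lambda>n. fib_fus (a ! n) (b ! n)" l] by simp
  show "fus (fib_power_data u l) a b = fus (fib_power_data u l) b a"
    by (simp add: fib_fus_commute)
next
  fix a assume "a \<in> simples (fib_power_data u l)"
  then have a: "length a = l" by simp
  show "fus (fib_power_data u l) (one (fib_power_data u l)) a = {a}"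
    "fus (fib_power_data u l) a (one (fib_power_data u l)) = {a}"
    using a by (auto intro!: nth_equalityI)
next
  fix a b c d e e' :: "fib list"
  let ?D = "fib_power_data u l"
  assume e: "e \<in> fus ?D a b" "d \<in> fus ?D e c" "e' \<in> fus ?D a b" "d \<in> fus ?D e' c"
  let ?S = "\<lambda>n. {f \<in> fib_fus (b ! n) (c ! n). d ! n \<in> fib_fus (a ! n) f}"
  let ?g = "\<lambda>n f. fib_F (u + inverse u) (a ! n) (b ! n) (c ! n) (d ! n) f (e' ! n) *
     fib_F (u + inverse u) (a ! n) (b ! n) (c ! n) (d ! n) (e ! n) f"
  have S: "{f. f \<in> fus ?D b c \<and> d \<in> fus ?D a f} = {f. length f = l \<and> (\<forall>n<l. f ! n \<in> ?S n)}"
    using e by auto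
  have "(\<Sum>f | f \<in> fus ?D b c \<and> d \<in> fus ?D a f. Fsym ?D a b c d f e' * Fsym ?D a b c d e f) =
      (\<Prod>n<l. \<Sum>f\<in>?S n. ?g n f)"
    unfolding S by (subst sum_lists_prod[symmetric]) (simp_all add: prod.distrib)
  also have "\<dots> = (\<Prod>n<l. of_bool (e' ! n = e ! n))"
    by (intro prod.cong refl fib_F_involutive(1)[OF u]) (use e in auto)
  also have "\<dots> = of_bool (e' = e)"
    using e by (subst prod_of_bool) (auto simp: list_eq_iff_nth_eq)
  finally show "(\<Sum>f | f \<in> fus ?D b c \<and> d \<in> fus ?D a f. Fsym ?D a b c d f e' * Fsym ?D a b c d e f) =
      of_bool (e' = e)" .
next
  fix a b c d f f' :: "fib list"
  let ?D = "fib_power_data u l"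
  assume f: "f \<in> fus ?D b c" "d \<in> fus ?D a f" "f' \<in> fus ?D b c" "d \<in> fus ?D a f'"
  let ?S = "\<lambda>n. {e \<in> fib_fus (a ! n) (b ! n). d ! n \<in> fib_fus e (c ! n)}"
  let ?g = "\<lambda>n e. fib_F (u + inverse u) (a ! n) (b ! n) (c ! n) (d ! n) e (f' ! n) *
     fib_F (u + inverse u) (a ! n) (b ! n) (c ! n) (d ! n) (f ! n) e"
  have S: "{e. e \<in> fus ?D a b \<and> d \<in> fus ?D e c} = {e. length e = l \<and> (\<forall>n<l. e ! n \<in> ?S n)}"
    using f by auto
  have "(\<Sum>e | e \<in> fus ?D a b \<and> d \<in> fus ?D e c. Fsym ?D a b c d e f' * Fsym ?D a b c d f e) =
      (\<Prod>n<l. \<Sum>e\<in>?S n. ?g n e)"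
    unfolding S by (subst sum_lists_prod[symmetric]) (simp_all add: prod.distrib)
  also have "\<dots> = (\<Prod>n<l. of_bool (f' ! n = f ! n))"
    by (intro prod.cong refl fib_F_involutive(2)[OF u]) (use f in auto)
  also have "\<dots> = of_bool (f' = f)"
    using f by (subst prod_of_bool) (auto simp: list_eq_iff_nth_eq)
  finally show "(\<Sum>e | e \<in> fus ?D a b \<and> d \<in> fus ?D e c. Fsym ?D a b c d e f' * Fsym ?D a b c d f e) =
      of_bool (f' = f)" .
qed (simp_all add: fib_F_one)

text \<open>As u^5 = -1 while u is not -1, u is a root of
  \<open>u ^ 4 - u ^ 3 + u ^ 2 - u + 1\<close>, the tenth cyclotomic polynomial. Division by u^2
  turns this into the equation for u + 1/u.\<close>

lemma golden_ratio_root_of_unity: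
  fixes u :: "'k::field"
  assumes "u ^ 10 = 1" "u ^ 2 \<noteq> 1" "u ^ 5 \<noteq> 1"
  shows "(u + inverse u) ^ 2 = u + inverse u + 1"
proof -
  have "u \<noteq> 0"
    using assms(1) by auto
  have "(u ^ 5 - 1) * (u ^ 5 + 1) = 0"
    using assms(1) by (simp add: algebra_simps flip: power_add)
  then have "u ^ 5 + 1 = 0"
    using assms(3) by simp
  then have "(u + 1) * (u ^ 4 - u ^ 3 + u ^ 2 - u + 1) = 0"
    by (simp add: algebra_simps power_numeral_reduce)
  moreover have "u + 1 \<noteq> 0"
    using assms(2) by (metis add_eq_0_iff2 power2_minus power_one)
  ultimately have "u ^ 4 - u ^ 3 + u ^ 2 - u + 1 = 0" by simp
  then have "u ^ 2 * ((u + inverse u) ^ 2 - (u + inverse u + 1)) = 0"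
    using \<open>u \<noteq> 0\<close> by (simp add: field_simps power_numeral_reduce)
  then show ?thesis
    using \<open>u \<noteq> 0\<close> by simp
qed

section \<open>Complete anisotropy\<close>

definition weight :: "fib list \<Rightarrow> nat" where
  "weight w = card {n. n < length w \<and> w ! n = X}"

lemma X_iff: "a = X \<longleftrightarrow> a \<noteq> I"
  by (cases a) auto

lemma weight_eq_0_iff: "weight w = 0 \<longleftrightarrow> w = replicate (length w) I"
proof -
  have "weight w = 0 \<longleftrightarrow> (\<forall>n<length w. w ! n = I)"
    by (auto simp: weight_def X_iff)
  also have "\<dots> \<longleftrightarrow> w = replicate (length w) I"
    by (auto simp: list_eq_iff_nth_eq)
  finally show ?thesis .
qed

lemma twsym_fib_power: "length w = l \<Longrightarrow> twsym (fib_power_data u l) w = inverse (u ^ 2) ^ weight w"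
proof -
  assume l: "length w = l"
  have "(\<Prod>n<l. case w ! n of I \<Rightarrow> 1 | X \<Rightarrow> inverse (u ^ 2)) = (\<Prod>n<l. if w ! n = X then inverse (u ^ 2) else 1)"
    by (intro prod.cong refl) (auto split: fib.splits)
  also have "\<dots> = (\<Prod>n\<in>{n\<in>{..<l}. w ! n = X}. inverse (u ^ 2))"
    by (rule prod.inter_filter[symmetric]) simp
  also have "\<dots> = inverse (u ^ 2) ^ weight w"
    by (simp add: weight_def l)
  finally show ?thesis by simp
qed

text \<open>Here \<open>i\<close>, \<open>j\<close>, \<open>k\<close> are the x, y, z of the
  overview, and products are read off in the coefficient of \<open>i\<close> itself:
  \<open>?t\<close> belongs to x(y,z) and \<open>?R\<close> to x[y,z]. Reading at \<open>i\<close>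
  makes the factor \<open>?m i i q0\<close> of \<open>?t\<close> non-zero by the unit law.\<close>

lemma minimal_weight_pairing_zero:
  fixes u :: "'k::field" and \<A> :: "(fib list sobj, (fib list, 'k) arrow) alg"
  assumes u: "(u + inverse u) ^ 2 = u + inverse u + 1"
    and alg: "is_algebra (cat_of (fib_power_data u l)) \<A>"
    and q0: "{p \<in> car \<A>. lab p = replicate l I} = {q0}"
    and i: "i \<in> car \<A>" "lab i = w" and j: "j \<in> car \<A>" "lab j = w" and k: "k \<in> car \<A>" "lab k = w"
    and min: "\<And>p. p \<in> car \<A> \<Longrightarrow> lab p \<noteq> replicate l I \<Longrightarrow> weight w \<le> weight (lab p)"
    and w3: "weight w \<ge> 3"
  shows "sconst \<A> q0 j k = 0"
proof -
  interpret involutive_fusion_data "fib_power_data u l"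
    by (rule fib_power_involutive[OF u])
  note A = algebraD[OF alg]
  let ?A = "car \<A>" and ?m = "sconst \<A>" and ?D = "fib_power_data u l" and ?one = "replicate l I"
  define a where "a = u + inverse u"
  have a2: "a * a = a + 1"
    using u by (simp add: a_def power2_eq_square)
  have a0: "a \<noteq> 0"
    using a2 by auto
  have q0A: "q0 \<in> ?A" and q0l: "lab q0 = ?one" and q0u: "\<And>p. p \<in> ?A \<Longrightarrow> lab p = ?one \<Longrightarrow> p = q0"
    using q0 by blast+
  have lw: "length w = l"
    using A(2)[OF i(1)] i(2) by simp
  have wone: "w \<noteq> ?one"
    using w3 weight_eq_0_iff[of w] lw by auto
  \<comment> \<open>Three positions carry the argument: \<open>n1\<close> lies in both channels used
    below, \<open>n2\<close> only in the second, and \<open>n3\<close> in neither, which keeps both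
    lighter than \<open>w\<close>.\<close>
  obtain T where T: "T \<subseteq> {n. n < length w \<and> w ! n = X}" "card T = 3"
    using w3 unfolding weight_def by (meson obtain_subset_with_card_n)
  obtain n1 n2 n3 where T3: "T = {n1, n2, n3}" and neq: "n1 \<noteq> n2" "n1 \<noteq> n3" "n2 \<noteq> n3"
    using T(2)[unfolded card_3_iff] by (elim exE conjE) (rule that; assumption)
  have n: "n1 < l" "n2 < l" "n3 < l" "w ! n1 = X" "w ! n2 = X" "w ! n3 = X"
    using T(1) unfolding T3 lw by auto
  note n = n neq
  \<comment> \<open>The power (-a)^m, written over positions to match the symbols of the Deligne
    power.\<close>
  define c where "c = (\<Prod>n<l. if w ! n = X then - a else 1)"
  have c0: "c \<noteq> 0"
    using a0 by (auto simp: c_def)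
  let ?t = "?m i i q0 * ?m q0 j k"
  let ?R = "\<Sum>q | q \<in> ?A \<and> lab q = w. ?m i i q * ?m q j k"
  \<comment> \<open>The channel \<open>e\<close> is supported inside \<open>w\<close>;
    \<open>n1\<close> keeps it from being the unit and \<open>n3\<close> keeps its weight below that
    of \<open>w\<close>.\<close>
  have rel: "c * ?t + (\<Prod>n<l. if e ! n = X then a else 1) * ?R = 0"
    if e: "length e = l" "\<And>n. n < l \<Longrightarrow> e ! n = X \<Longrightarrow> w ! n = X" "e ! n1 = X" "e ! n3 = I" for e
  proof -
    have eone: "e \<noteq> ?one"
      using e(3) n(1) by auto
    have "{n. n < length e \<and> e ! n = X} \<subset> {n. n < length w \<and> w ! n = X}"
    proof
      show "{n. n < length e \<and> e ! n = X} \<subseteq> {n. n < length w \<and> w ! n = X}"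
      proof (intro subsetI CollectI)
        fix n assume "n \<in> {n. n < length e \<and> e ! n = X}"
        then show "n < length w \<and> w ! n = X"
          using e(1) e(2)[of n] lw by simp
      qed
      have "n3 \<notin> {n. n < length e \<and> e ! n = X}" "n3 \<in> {n. n < length w \<and> w ! n = X}"
        using e(4) n(3,6) lw by simp_all
      then show "{n. n < length e \<and> e ! n = X} \<noteq> {n. n < length w \<and> w ! n = X}"
        by blast
    qed
    then have we: "weight e < weight w"
      unfolding weight_def by (intro psubset_card_mono) auto
    have fus1: "e \<in> fus ?D (lab i) (lab j)"
    proof -
      have "e ! n \<in> fib_fus (w ! n) (w ! n)" if "n < l" for n
        using e(2)[OF that] by (cases "e ! n"; cases "w ! n") auto
      then show ?thesis using e(1) i j by simp
    qed
    have fus2: "lab i \<in> fus ?D e (lab k)"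
    proof -
      have "w ! n \<in> fib_fus (e ! n) (w ! n)" if "n < l" for n
        using e(2)[OF that] by (cases "e ! n"; cases "w ! n") auto
      then show ?thesis using lw i k by simp
    qed
    have none: "{p. p \<in> ?A \<and> lab p = e} = {}"
      using min we eone by fastforce
    have "0 = (\<Sum>q\<in>?A. Fsym ?D w w w w e (lab q) * (?m i i q * ?m q j k))"
      using A(5)[OF i(1) j(1) k(1) i(1) fus1 fus2] unfolding none i(2) j(2) k(2) by simp
    also have "\<dots> = (\<Sum>q\<in>insert q0 {q \<in> ?A. lab q = w}. Fsym ?D w w w w e (lab q) * (?m i i q * ?m q j k))"
    proof (rule sum.mono_neutral_right)
      show "\<forall>q\<in>?A - insert q0 {q \<in> ?A. lab q = w}. Fsym ?D w w w w e (lab q) * (?m i i q * ?m q j k) = 0"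
      proof
        fix q assume q: "q \<in> ?A - insert q0 {q \<in> ?A. lab q = w}"
        \<comment> \<open>A component of the product of \<open>j\<close> and \<open>k\<close> has
          its support inside that of \<open>w\<close>, so minimality leaves only the unit label and
          \<open>w\<close> itself.\<close>
        have "?m q j k = 0"
        proof (rule ccontr)
          assume "?m q j k \<noteq> 0"
          then have lq: "length (lab q) = l" "\<And>n. n < l \<Longrightarrow> lab q ! n \<in> fib_fus (w ! n) (w ! n)"
            using A(8)[of q j k] j k by auto
          have sub: "{n. n < length (lab q) \<and> lab q ! n = X} \<subseteq> {n. n < length w \<and> w ! n = X}"
          proof clarify
            fix n assume "n < length (lab q)" "lab q ! n = X"
            then show "n < length w \<and> w ! n = X"
              using lq lw by (cases "w ! n") force+
          qed
          have "lab q \<noteq> ?one"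
            using q q0u by auto
          then have "weight w \<le> weight (lab q)"
            using min q by auto
          then have "{n. n < length (lab q) \<and> lab q ! n = X} = {n. n < length w \<and> w ! n = X}"
            unfolding weight_def using sub by (intro card_seteq) auto
          then have mem: "n \<in> {n. n < length (lab q) \<and> lab q ! n = X} \<longleftrightarrow> n \<in> {n. n < length w \<and> w ! n = X}" for n
            by (rule arg_cong)
          have same: "lab q ! n = X \<longleftrightarrow> w ! n = X" if "n < l" for n
            using mem[of n] that lq(1) lw by simp
          have "lab q ! n = w ! n" if "n < l" for n
            using same[OF that] by (cases "lab q ! n"; cases "w ! n") auto
          then have "lab q = w"
            using lq(1) lw by (intro nth_equalityI) simp_all
          with q show False by auto
        qed
        then show "Fsym ?D w w w w e (lab q) * (?m i i q * ?m q j k) = 0" by simp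
      qed
    qed (use A(1) q0A in auto)
    also have "\<dots> = Fsym ?D w w w w e ?one * ?t +
        (\<Sum>q | q \<in> ?A \<and> lab q = w. Fsym ?D w w w w e w * (?m i i q * ?m q j k))"
      using A(1) q0l wone by (subst sum.insert) auto
    also have "Fsym ?D w w w w e ?one = c"
    proof -
      have "fib_F a (w ! n) (w ! n) (w ! n) (w ! n) (e ! n) I = (if w ! n = X then - a else 1)" for n
        by (cases "w ! n"; cases "e ! n") auto
      then show ?thesis
        by (simp add: c_def a_def[symmetric])
    qed
    also have "Fsym ?D w w w w e w = (\<Prod>n<l. if e ! n = X then a else 1)"
    proof -
      \<comment> \<open>Where \<open>w\<close> has the letter \<open>I\<close>, so has
        \<open>e\<close>, and the symbol is 1.\<close>
      have "fib_F a (w ! n) (w ! n) (w ! n) (w ! n) (e ! n) (w ! n) = (if e ! n = X then a else 1)"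
        if "n < l" for n
        using e(2)[OF that] by (cases "w ! n"; cases "e ! n") auto
      then show ?thesis
        by (simp add: a_def[symmetric])
    qed
    finally show ?thesis
      by (simp add: sum_distrib_left)
  qed
  \<comment> \<open>The channels with r = 1 and r = 2.\<close>
  define e1 where "e1 = map (\<lambda>n. if n = n1 then X else I) [0..<l]"
  define e2 where "e2 = map (\<lambda>n. if n = n1 \<or> n = n2 then X else I) [0..<l]"
  have "(\<Prod>m<l. if e1 ! m = X then a else 1) = (\<Prod>m<l. if m = n1 then a else 1)"
    by (intro prod.cong refl) (auto simp: e1_def)
  also have "\<dots> = a"
    using n by simp
  finally have p1: "(\<Prod>m<l. if e1 ! m = X then a else 1) = a" .
  have "c * ?t + (\<Prod>m<l. if e1 ! m = X then a else 1) * ?R = 0"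
    by (rule rel) (use n in \<open>auto simp: e1_def split: if_splits\<close>)
  then have r1: "c * ?t + a * ?R = 0"
    unfolding p1 .
  have "(\<Prod>m<l. if e2 ! m = X then a else 1) = (\<Prod>m<l. (if m = n1 then a else 1) * (if m = n2 then a else 1))"
    by (intro prod.cong refl) (use n in \<open>auto simp: e2_def\<close>)
  also have "\<dots> = a * a"
    using n by (simp add: prod.distrib)
  finally have p2: "(\<Prod>m<l. if e2 ! m = X then a else 1) = a * a" .
  have "c * ?t + (\<Prod>m<l. if e2 ! m = X then a else 1) * ?R = 0"
    by (rule rel) (use n in \<open>auto simp: e2_def split: if_splits\<close>)
  then have r2: "c * ?t + (a * a) * ?R = 0"
    unfolding p2 .
  \<comment> \<open>Since a^2 - a = 1, the difference of the two relations is \<open>?R\<close>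
    itself.\<close>
  have "?R = (c * ?t + a * a * ?R) - (c * ?t + a * ?R)"
    unfolding a2 by (simp add: algebra_simps)
  then have "?R = 0"
    using r1 r2 by simp
  then have t0: "?t = 0"
    using r1 c0 by simp
  \<comment> \<open>The unit of \<open>A\<close> is concentrated on \<open>q0\<close>, so the right
    unit law at \<open>i\<close> shows that \<open>?m i i q0\<close> is non-zero.\<close>
  have "(\<Sum>q\<in>?A. ?m i i q * ucoef ?D \<A> q) = 1"
    using A(7)[OF i(1) i(1)] by simp
  moreover have "(\<Sum>q\<in>?A. ?m i i q * ucoef ?D \<A> q) = (\<Sum>q\<in>{q0}. ?m i i q * ucoef ?D \<A> q)"
  proof (rule sum.mono_neutral_right)
    show "\<forall>q\<in>?A - {q0}. ?m i i q * ucoef ?D \<A> q = 0"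
    proof
      fix q assume q: "q \<in> ?A - {q0}"
      have "ucoef ?D \<A> q = 0"
      proof (rule ccontr)
        assume "ucoef ?D \<A> q \<noteq> 0"
        then have "lab q = ?one"
          using A(9)[of q] by simp
        with q q0u show False by blast
      qed
      then show "?m i i q * ucoef ?D \<A> q = 0" by simp
    qed
  qed (use A(1) q0A in auto)
  ultimately have "?m i i q0 \<noteq> 0" by auto
  with t0 show ?thesis by simp
qed

text \<open>On a single unit summand the multiplication is one scalar \<open>m\<close> and the unit
  one scalar \<open>c\<close>, with \<open>m * c = 1\<close> by the unit law. The isomorphism is the
  inverse of the unit morphism.\<close>

lemma alg_isomorphic_unit:
  assumes D: "unital_fusion_data D" and alg: "is_algebra (cat_of D) \<A>"
    and car: "car \<A> = {q}" and q: "lab q = one D"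
  shows "alg_isomorphic (cat_of D) \<A> (unit_alg (cat_of D))"
proof -
  interpret unital_fusion_data D by fact
  note A = algebraD[OF alg]
  let ?U = "unit_summand D"
  define c where "c = ent (unit \<A>) q ?U"
  define m where "m = ent (mult \<A>) q (Node (one D) q q)"
  have mc: "m * c = 1"
    using A(6)[of q q] by (simp add: car m_def c_def sconst_def ucoef_def q)
  have m: "m = inverse c"
    using mc by (metis inverse_unique mult.commute)
  have c0: "c \<noteq> 0" using mc by auto
  have fus: "fus D (one D) (one D) = {one D}"
    using fus_one(1)[OF one_simple] .
  have T: "tens_obj D {q} {q} = {Node (one D) q q}" "tens_obj D {?U} {?U} = {Node (one D) ?U ?U}"
    by (auto simp: tens_obj_def q fus)
  define f where "f = mk_arrow {q} {?U} (\<lambda>y x. inverse c)"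
  have f: "f \<in> hom_set {q} {?U}" "src f = {q}" "tgt f = {?U}"
    by (simp_all add: f_def)
  note s = hom_setD(1,2)[OF A(3), unfolded car T] hom_setD(1,2)[OF A(4), unfolded car]
  have ef: "ent f ?U q = inverse c"
    by (simp add: f_def q)
  have "comp_arrow f (mult \<A>) = comp_arrow (mk_arrow {Node (one D) ?U ?U} {?U} (\<lambda>y x. of_bool (x = Node (lab y) ?U y))) (tens_arrow D f f)"
    (is "?l = comp_arrow ?L _")
  proof (rule hom_set_eqI)
    show "?l \<in> hom_set {Node (one D) q q} {?U}" "comp_arrow ?L (tens_arrow D f f) \<in> hom_set {Node (one D) q q} {?U}"
      using comp_arrow_in_hom_set[of f "mult \<A>"] comp_arrow_in_hom_set[of ?L "tens_arrow D f f"]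
      by (simp_all add: s f T)
    fix x y assume "x \<in> {Node (one D) q q}" "y \<in> {?U}"
    then show "ent ?l y x = ent (comp_arrow ?L (tens_arrow D f f)) y x"
      by (simp add: ent_comp_arrow ent_tens_arrow s f T ef q m_def[symmetric] m)
  qed
  moreover have fu: "comp_arrow f (unit \<A>) = id_arrow {?U}"
  proof (rule hom_set_eqI)
    show "comp_arrow f (unit \<A>) \<in> hom_set {?U} {?U}"
      using comp_arrow_in_hom_set[of f "unit \<A>"] by (simp add: s f)
    fix x y assume "x \<in> {?U}" "y \<in> {?U}"
    then show "ent (comp_arrow f (unit \<A>)) y x = ent (id_arrow {?U}) y x"
      using c0 by (simp add: ent_comp_arrow s f ef c_def[symmetric])
  qed simp
  moreover have "comp_arrow (unit \<A>) f = id_arrow {q}"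
  proof (rule hom_set_eqI)
    show "comp_arrow (unit \<A>) f \<in> hom_set {q} {q}"
      using comp_arrow_in_hom_set[of "unit \<A>" f] by (simp add: s f)
    fix x y assume "x \<in> {q}" "y \<in> {q}"
    then show "ent (comp_arrow (unit \<A>) f) y x = ent (id_arrow {q}) y x"
      using c0 by (simp add: ent_comp_arrow s f ef c_def[symmetric])
  qed simp
  ultimately show ?thesis
    unfolding alg_isomorphic_def alg_hom_def iso_arrow_def unit_alg_def
    using f(1) A(4) by (intro exI[of _ f]) (auto simp: car T)
qed

theorem theorem22:
  fixes u :: "'k::{alg_closed_field, field_char_0}" and l :: nat
    and \<A> :: "(fib list sobj, (fib list, 'k) arrow) alg"
  assumes "u ^ 10 = 1" and "\<forall>m::nat. 0 < m \<and> m < 10 \<longrightarrow> u ^ m \<noteq> 1"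
    and "l \<ge> 1"
    and "is_algebra (fib_power u l) \<A>"
    and "simple_alg (fib_power u l) \<A>"
    and "separable_alg (fib_power u l) \<A>"
    and "commutative_alg (fib_power u l) \<A>"
    and "ribbon_alg (fib_power u l) \<A>"
  shows "alg_isomorphic (fib_power u l) \<A> (unit_alg (fib_power u l))"
proof -
  let ?D = "fib_power_data u l" and ?A = "car \<A>" and ?one = "replicate l I"
  note alg = assms(4)[unfolded fib_power_def]
  have u2: "u ^ 2 \<noteq> 1" and u4: "u ^ 4 \<noteq> 1" and u5: "u ^ 5 \<noteq> 1"
    using assms(2) by simp_all
  have golden: "(u + inverse u) ^ 2 = u + inverse u + 1"
    by (rule golden_ratio_root_of_unity[OF assms(1) u2 u5])
  interpret involutive_fusion_data ?D
    by (rule fib_power_involutive[OF golden])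
  note A = algebraD[OF alg]
  obtain q0 where q0: "{p \<in> ?A. lab p = ?one} = {q0}"
    using simple_commutative_connected[OF unital_fusion_data_axioms alg] assms(5,7)
    unfolding fib_power_def by auto
  have "lab p = ?one" if p: "p \<in> ?A" for p
  proof (rule ccontr)
    assume "lab p \<noteq> ?one"
    then obtain i where i: "i \<in> ?A" "lab i \<noteq> ?one"
      and min: "\<And>j. j \<in> ?A \<Longrightarrow> lab j \<noteq> ?one \<Longrightarrow> weight (lab i) \<le> weight (lab j)"
      using ex_has_least_nat[of "\<lambda>j. j \<in> ?A \<and> lab j \<noteq> ?one" p "\<lambda>j. weight (lab j)"] p by blast
    have li: "length (lab i) = l"
      using A(2)[OF i(1)] by simp
    have "ent (Twist (cat_of ?D) ?A) i i = ent (Idm (cat_of ?D) ?A) i i"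
      using assms(8) by (simp add: ribbon_alg_def fib_power_def)
    then have "twsym ?D (lab i) = 1"
      using i(1) by (simp del: fib_power_data_simps)
    then have tw: "(u ^ 2) ^ weight (lab i) = 1"
      unfolding twsym_fib_power[OF li] by (metis inverse_1 inverse_inverse_eq power_inverse)
    \<comment> \<open>Weight 0 is the unit label, and weights 1 and 2 would give u^2 = 1 and u^4 =
      1.\<close>
    have w3: "weight (lab i) \<ge> 3"
    proof (rule ccontr)
      assume "\<not> weight (lab i) \<ge> 3"
      moreover have "weight (lab i) \<noteq> 0"
        using weight_eq_0_iff[of "lab i"] i(2) li by simp
      ultimately have "weight (lab i) = 1 \<or> weight (lab i) = 2" by linarith
      then show False
        using tw u2 u4 by (auto simp flip: power_mult)
    qed
    obtain y j where y: "y \<in> ?A" "j \<in> ?A" "lab y = one ?D" "sconst \<A> y i j \<noteq> 0"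
      using separable_pairing[OF alg _ i(1)] assms(6) unfolding fib_power_def by blast
    have "y = q0"
      using y(1,3) q0 by auto
    have lj: "length (lab j) = l"
      using A(2)[OF y(2)] by simp
    \<comment> \<open>The letters are self-dual: \<open>I\<close> occurs in a product of two letters
      only if they agree. So the partner \<open>j\<close> of \<open>i\<close> has the same
      label.\<close>
    have "lab i ! n = lab j ! n" if "n < l" for n
    proof -
      have "I \<in> fib_fus (lab i ! n) (lab j ! n)"
        using A(8)[OF y(4)] y(3) that by auto
      then show ?thesis
        by (cases "lab i ! n"; cases "lab j ! n") auto
    qed
    then have "lab j = lab i"
      using li lj by (intro nth_equalityI) auto
    \<comment> \<open>Both x and y are taken to be \<open>i\<close>, and z is its partner
      \<open>j\<close>.\<close>
    then have "sconst \<A> q0 i j = 0"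
      using minimal_weight_pairing_zero[OF golden alg q0 i(1) refl i(1) refl y(2) _ min w3] by blast
    with y(4) \<open>y = q0\<close> show False by simp
  qed
  then have "?A = {q0}" "lab q0 = one ?D"
    using q0 by auto
  then show ?thesis
    unfolding fib_power_def by (rule alg_isomorphic_unit[OF unital_fusion_data_axioms alg])
qed

end
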